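(* For all integers $n\ge 1$ and $k\ge 0$, the product $\mu^n\times I^k$ does not embed in $\mathbb{R}^{2n+k}$.
   Context: $\mu^n$ denotes the $n$-dimensional universal Menger compactum (the standard Menger cube in $[0,1]^{2n+1}$, which is $n$-dimensional and contains a copy of every compact metrizable space of dimension at most $n$). $I=[0,1]$. Embeddings are topological. *)

theory Defs
  imports "HOL-Analysis.Analysis"
begin

text \<open>
  Points of \<open>m\<close>-space are functions \<open>nat \<Rightarrow> real\<close> vanishing from index \<open>m\<close> on, as in
  \<^const>\<open>Euclidean_space\<close>. The closed cube of side \<open>1 / 3 ^ j\<close> with lower corner \<open>a / 3 ^ j\<close> is
  coded by the level \<open>j\<close> and the integer vector \<open>a\<close>; the entries \<open>a i\<close> with \<open>m \<le> i\<close> are irrelevant.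
\<close>

definition grid_cube :: "nat \<Rightarrow> nat \<Rightarrow> (nat \<Rightarrow> nat) \<Rightarrow> (nat \<Rightarrow> real) set" where
  "grid_cube m j a =
     {x \<in> topspace (Euclidean_space m). \<forall>i<m. real (a i) / 3 ^ j \<le> x i \<and> x i \<le> (real (a i) + 1) / 3 ^ j}"

text \<open>
  The union of the faces of dimension at most \<open>n\<close>: a point of the cube lies in it iff at most \<open>n\<close> of
  its coordinates are strictly between the two endpoints.
\<close>

definition cube_skeleton :: "nat \<Rightarrow> nat \<Rightarrow> nat \<Rightarrow> (nat \<Rightarrow> nat) \<Rightarrow> (nat \<Rightarrow> real) set" where
  "cube_skeleton n m j a =
     {x \<in> grid_cube m j a.
        card {i. i < m \<and> x i \<noteq> real (a i) / 3 ^ j \<and> x i \<noteq> (real (a i) + 1) / 3 ^ j} \<le> n}"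

text \<open>
  Menger's construction: each cube kept at level \<open>j\<close> is subdivided into \<open>3 ^ m\<close> congruent subcubes,
  of which those meeting the \<open>n\<close>-skeleton of the subdivided cube are kept.
\<close>

primrec menger_cubes :: "nat \<Rightarrow> nat \<Rightarrow> nat \<Rightarrow> (nat \<Rightarrow> nat) set" where
  "menger_cubes n m 0 = {\<lambda>i. 0}"
| "menger_cubes n m (Suc j) =
     {b. \<exists>a \<in> menger_cubes n m j.
           (\<forall>i<m. b i \<in> {3 * a i, 3 * a i + 1, 3 * a i + 2}) \<and>
           grid_cube m (Suc j) b \<inter> cube_skeleton n m j a \<noteq> {}}"

definition menger_set :: "nat \<Rightarrow> nat \<Rightarrow> (nat \<Rightarrow> real) set" where
  "menger_set n m = (\<Inter>j. \<Union>a \<in> menger_cubes n m j. grid_cube m j a)"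

definition menger_compactum :: "nat \<Rightarrow> (nat \<Rightarrow> real) topology" where
  "menger_compactum n = subtopology (Euclidean_space (2 * n + 1)) (menger_set n (2 * n + 1))"

definition unit_cube :: "nat \<Rightarrow> (nat \<Rightarrow> real) topology" where
  "unit_cube k = subtopology (Euclidean_space k) {x. \<forall>i<k. 0 \<le> x i \<and> x i \<le> 1}"

end

theory Submission
  imports Defs "HOL-Library.Z2"
begin

text \<open>
  Suppose that \<open>f\<close> embeds \<open>\<mu>\<^sup>n \<times> I\<^sup>k\<close> in \<open>\<real>\<close> to the power \<open>2 * n + k\<close>. From a point
  \<open>p = (q, u)\<close> of the octahedral sphere of dimension \<open>2 * n + k + 1\<close>, where \<open>q\<close> has \<open>2 * n + 2\<close>
  coordinates, read off \<open>x(q) \<in> \<mu>\<^sup>n\<close> and \<open>v(u) \<in> I\<^sup>k\<close> with \<open>v(- u) = 1 - v(u)\<close>. The point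
  \<open>x(q)\<close> is defined on the zero set of an odd real function, the balance: as in the theorem of
  van Kampen and Flores, \<open>q\<close> represents a point of the deleted join of a simplex with
  \<open>2 * n + 3\<close> vertices, and balance keeps the positive and the negative part of \<open>q\<close> both in the
  \<open>n\<close>-skeleton. Hence \<open>x(q) \<noteq> x(- q)\<close>. By the Borsuk-Ulam theorem the balance and the odd map
  \<open>f(x(q), v(u)) - f(x(- q), v(- u))\<close> have a common zero, which contradicts injectivity. Near
  \<open>q = 0\<close>, where \<open>x(q)\<close> is undefined, \<open>v(u)\<close> is on the boundary of the cube and hence far from
  \<open>v(- u)\<close>; there \<open>x\<close> may be faded to a fixed point, because all \<open>x(q)\<close> can be taken
  arbitrarily close to it.

  The Borsuk-Ulam theorem is proved with mod 2 chains: the number of simplices of an iterated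
  barycentric subdivision of a hemisphere on which all of the given odd functions change sign is odd.
\<close>

section \<open>Mod 2 cochains on lists of vertices\<close>

declare add_bit_eq_xor [simp del] mult_bit_eq_and [simp del]

lemma bit_add_self [simp]: "x + x = (0::bit)"
  by (cases x) simp_all

lemma bit_add_self_left [simp]: "x + (x + y) = (y::bit)"
  by (simp flip: add.assoc)

text \<open>The mod 2 simplicial coboundary of \<open>\<phi>\<close>, evaluated at the simplex
  \<open>\<sigma>\<close>. Simplices are lists because the cochains used below depend on the order
  of the vertices; mod 2 no signs arise.\<close>

primrec coboundary :: "'a list \<Rightarrow> ('a list \<Rightarrow> bit) \<Rightarrow> bit" where
  "coboundary [] \<phi> = 0"
| "coboundary (v # \<sigma>) \<phi> = \<phi> \<sigma> + coboundary \<sigma> (\<lambda>\<tau>. \<phi> (v # \<tau>))"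

lemma coboundary_add:
  "coboundary \<sigma> (\<lambda>\<tau>. \<phi> \<tau> + \<psi> \<tau>) = coboundary \<sigma> \<phi> + coboundary \<sigma> \<psi>"
  by (induction \<sigma> arbitrary: \<phi> \<psi>) (simp_all add: algebra_simps)

lemma coboundary_mult: "coboundary \<sigma> (\<lambda>\<tau>. c * \<phi> \<tau>) = c * coboundary \<sigma> \<phi>"
  by (induction \<sigma> arbitrary: \<phi>) (simp_all add: algebra_simps)

text \<open>Faces that omit the head and one more vertex occur twice and cancel mod 2; for those
  that keep the head the induction hypothesis applies.\<close>

lemma coboundary_coboundary: "coboundary \<sigma> (\<lambda>\<tau>. coboundary \<tau> \<phi>) = 0"
  by (induction \<sigma> arbitrary: \<phi>) (simp_all add: coboundary_add)

lemma coboundary_map: "coboundary (map g \<sigma>) \<phi> = coboundary \<sigma> (\<lambda>\<tau>. \<phi> (map g \<tau>))"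
  by (induction \<sigma> arbitrary: \<phi>) simp_all

text \<open>This lemma, \<open>subdivide_nonzero\<close> and \<open>hemisphere_nonzero\<close>
  recover actual simplices from sums that do not vanish, so that no subdivided complex has to be
  written down.\<close>

lemma coboundary_nonzero:
  assumes "coboundary \<sigma> \<phi> \<noteq> 0"
  obtains \<tau> where "\<phi> \<tau> \<noteq> 0" "set \<tau> \<subseteq> set \<sigma>" "length \<sigma> = Suc (length \<tau>)"
proof -
  have "\<exists>\<tau>. \<phi> \<tau> \<noteq> 0 \<and> set \<tau> \<subseteq> set \<sigma> \<and> length \<sigma> = Suc (length \<tau>)"
    using assms
  proof (induction \<sigma> arbitrary: \<phi>)
    case (Cons v \<sigma>)
    show ?case
    proof (cases "\<phi> \<sigma> = 0")
      case True
      with Cons.prems have "coboundary \<sigma> (\<lambda>\<tau>. \<phi> (v # \<tau>)) \<noteq> 0"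
        by simp
      from Cons.IH[OF this] obtain \<tau> where
        "\<phi> (v # \<tau>) \<noteq> 0" "set \<tau> \<subseteq> set \<sigma>" "length \<sigma> = Suc (length \<tau>)" by blast
      then show ?thesis by (intro exI[of _ "v # \<tau>"]) auto
    next
      case False
      then show ?thesis by (intro exI[of _ \<sigma>]) auto
    qed
  qed simp
  then show thesis using that by blast
qed

lemma coboundary_cong:
  assumes "\<And>\<tau>. length \<sigma> = Suc (length \<tau>) \<Longrightarrow> \<phi> \<tau> = \<psi> \<tau>"
  shows "coboundary \<sigma> \<phi> = coboundary \<sigma> \<psi>"
  using assms
proof (induction \<sigma> arbitrary: \<phi> \<psi>)
  case (Cons v \<sigma>)
  have "coboundary \<sigma> (\<lambda>\<tau>. \<phi> (v # \<tau>)) = coboundary \<sigma> (\<lambda>\<tau>. \<psi> (v # \<tau>))"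
    by (rule Cons.IH) (rule Cons.prems, simp)
  moreover have "\<phi> \<sigma> = \<psi> \<sigma>" by (rule Cons.prems) simp
  ultimately show ?case by simp
qed simp

section \<open>Barycentric subdivision and its mesh\<close>

definition barycenter :: "(nat \<Rightarrow> real) list \<Rightarrow> nat \<Rightarrow> real" where
  "barycenter \<sigma> i = (\<Sum>v\<leftarrow>\<sigma>. v i) / real (length \<sigma>)"

definition antipode :: "(nat \<Rightarrow> real) \<Rightarrow> nat \<Rightarrow> real" where
  "antipode x = (\<lambda>i. - x i)"

lemma antipode_apply: "antipode x i = - x i"
  by (simp only: antipode_def)

lemma antipode_antipode [simp]: "antipode (antipode x) = x"
  by (rule ext) (simp only: antipode_apply minus_minus)

lemma map_antipode_antipode [simp]: "map antipode (map antipode \<sigma>) = \<sigma>"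
  by (simp only: map_map o_def antipode_antipode map_ident)

lemma barycenter_antipode: "barycenter (map antipode \<sigma>) = antipode (barycenter \<sigma>)"
proof
  fix i
  have "(\<Sum>v\<leftarrow>map antipode \<sigma>. v i) = - (\<Sum>v\<leftarrow>\<sigma>. v i)"
    by (induction \<sigma>) (simp_all add: antipode_apply)
  then show "barycenter (map antipode \<sigma>) i = antipode (barycenter \<sigma>) i"
    by (simp only: barycenter_def antipode_apply length_map minus_divide_left)
qed

text \<open>
  The transpose of barycentric subdivision: the sum of \<open>\<phi>\<close> over the subdivision of the simplex
  with the \<open>n\<close> vertices \<open>\<sigma>\<close>.
\<close>

primrec subdivide :: "nat \<Rightarrow> ((nat \<Rightarrow> real) list \<Rightarrow> bit) \<Rightarrow> (nat \<Rightarrow> real) list \<Rightarrow> bit" where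
  "subdivide 0 \<phi> \<sigma> = \<phi> []"
| "subdivide (Suc n) \<phi> \<sigma> = coboundary \<sigma> (subdivide n (\<lambda>\<rho>. \<phi> (barycenter \<sigma> # \<rho>)))"

lemma subdivide_add:
  "subdivide n (\<lambda>\<tau>. \<phi> \<tau> + \<psi> \<tau>) = (\<lambda>\<sigma>. subdivide n \<phi> \<sigma> + subdivide n \<psi> \<sigma>)"
proof (induction n arbitrary: \<phi> \<psi>)
  case (Suc n)
  show ?case by (rule ext) (simp only: subdivide.simps Suc coboundary_add)
qed (simp add: fun_eq_iff)

text \<open>Subdivision is a chain map. The subdivided simplex is the cone from its barycenter over
  its subdivided boundary. The faces without the apex make up the subdivided boundary; those with
  the apex form a cone over the subdivided boundary of a boundary, hence cancel.\<close>

lemma subdivide_coboundary: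
  "length \<sigma> = Suc n \<Longrightarrow>
     subdivide (Suc n) (\<lambda>\<tau>. coboundary \<tau> \<phi>) \<sigma> = coboundary \<sigma> (subdivide n \<phi>)"
proof (induction n arbitrary: \<phi> \<sigma>)
  case 0
  then show ?case by (cases \<sigma>) simp_all
next
  case (Suc n)
  let ?\<psi> = "\<lambda>\<rho>. \<phi> (barycenter \<sigma> # \<rho>)"
  have "coboundary \<sigma> (subdivide (Suc n) (\<lambda>\<tau>. coboundary \<tau> ?\<psi>)) =
        coboundary \<sigma> (\<lambda>\<tau>. coboundary \<tau> (subdivide n ?\<psi>))"
    using Suc by (intro coboundary_cong) simp
  also have "\<dots> = 0" by (rule coboundary_coboundary)
  finally have z: "coboundary \<sigma> (subdivide (Suc n) (\<lambda>\<tau>. coboundary \<tau> ?\<psi>)) = 0" .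
  have "subdivide (Suc (Suc n)) (\<lambda>\<tau>. coboundary \<tau> \<phi>) \<sigma> =
        coboundary \<sigma> (subdivide (Suc n) (\<lambda>\<rho>. \<phi> \<rho> + coboundary \<rho> ?\<psi>))"
    by (simp only: subdivide.simps(2)[of "Suc n"] coboundary.simps)
  also have "\<dots> = coboundary \<sigma> (\<lambda>\<tau>. subdivide (Suc n) \<phi> \<tau> +
                     subdivide (Suc n) (\<lambda>\<rho>. coboundary \<rho> ?\<psi>) \<tau>)"
    by (simp only: subdivide_add)
  also have "\<dots> = coboundary \<sigma> (subdivide (Suc n) \<phi>)"
    by (simp only: coboundary_add z add_0_right)
  finally show ?case .
qed

lemma subdivide_antipode:
  "subdivide n (\<lambda>\<tau>. \<phi> (map antipode \<tau>)) = (\<lambda>\<sigma>. subdivide n \<phi> (map antipode \<sigma>))"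
proof (induction n arbitrary: \<phi>)
  case (Suc n)
  show ?case
  proof
    fix \<sigma>
    show "subdivide (Suc n) (\<lambda>\<tau>. \<phi> (map antipode \<tau>)) \<sigma> = subdivide (Suc n) \<phi> (map antipode \<sigma>)"
      using Suc[of "\<lambda>\<rho>. \<phi> (antipode (barycenter \<sigma>) # \<rho>)"]
      by (simp add: coboundary_map barycenter_antipode)
  qed
qed (simp add: fun_eq_iff)

lemma subdivide_cong:
  assumes "\<And>\<tau>. length \<tau> = n \<Longrightarrow> \<phi> \<tau> = \<psi> \<tau>"
  shows "length \<sigma> = n \<Longrightarrow> subdivide n \<phi> \<sigma> = subdivide n \<psi> \<sigma>"
  using assms
proof (induction n arbitrary: \<phi> \<psi> \<sigma>)
  case (Suc n)
  show ?case
    unfolding subdivide.simps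
    by (rule coboundary_cong, rule Suc.IH) (use Suc.prems in auto)
qed simp

text \<open>A weak form of convexity, sufficient to keep the vertices of all iterated subdivisions
  inside a set.\<close>

definition barycenter_closed :: "(nat \<Rightarrow> real) set \<Rightarrow> bool" where
  "barycenter_closed C \<longleftrightarrow> (\<forall>\<sigma>. \<sigma> \<noteq> [] \<longrightarrow> set \<sigma> \<subseteq> C \<longrightarrow> barycenter \<sigma> \<in> C)"

lemma barycenter_closedD: "barycenter_closed C \<Longrightarrow> \<sigma> \<noteq> [] \<Longrightarrow> set \<sigma> \<subseteq> C \<Longrightarrow> barycenter \<sigma> \<in> C"
  by (simp add: barycenter_closed_def)

lemma barycenter_closed_Int:
  "barycenter_closed C \<Longrightarrow> barycenter_closed D \<Longrightarrow> barycenter_closed (C \<inter> D)"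
  by (simp add: barycenter_closed_def)

lemma sum_list_abs_bound:
  assumes "\<And>v. v \<in> set \<sigma> \<Longrightarrow> \<bar>f v\<bar> \<le> (c::real)"
  shows "\<bar>\<Sum>v\<leftarrow>\<sigma>. f v\<bar> \<le> real (length \<sigma>) * c"
  using assms
proof (induction \<sigma>)
  case (Cons v \<sigma>)
  then have "\<bar>f v\<bar> \<le> c" "\<bar>\<Sum>v\<leftarrow>\<sigma>. f v\<bar> \<le> real (length \<sigma>) * c" by auto
  then show ?case by (simp add: algebra_simps)
qed simp

lemma barycenter_diff:
  assumes "\<sigma> \<noteq> []"
  shows "barycenter \<sigma> i - c = (\<Sum>v\<leftarrow>\<sigma>. v i - c) / real (length \<sigma>)"
proof -
  have "(\<Sum>v\<leftarrow>\<sigma>. v i - c) = (\<Sum>v\<leftarrow>\<sigma>. v i) - real (length \<sigma>) * c"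
    by (induction \<sigma>) (simp_all add: algebra_simps)
  then show ?thesis using assms by (simp add: barycenter_def field_simps)
qed

lemma barycenter_closed_box: "barycenter_closed {x. \<forall>i. \<bar>x i - b i\<bar> \<le> r}"
  unfolding barycenter_closed_def
proof (safe, goal_cases)
  case (1 \<sigma> i)
  have "\<bar>\<Sum>v\<leftarrow>\<sigma>. v i - b i\<bar> \<le> real (length \<sigma>) * r"
    by (rule sum_list_abs_bound) (use 1 in auto)
  then show ?case using 1 by (simp add: barycenter_diff field_simps)
qed

text \<open>Of the \<open>l\<close> summands \<open>v i - w i\<close> the one for \<open>w\<close>
  itself vanishes, so their mean is at most \<open>(1 - 1 / l) * D\<close> in absolute
  value.\<close>

lemma barycenter_vertex_distance:
  assumes "length \<sigma> \<le> K" "w \<in> set \<sigma>"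
    and D: "\<And>v w. v \<in> set \<sigma> \<Longrightarrow> w \<in> set \<sigma> \<Longrightarrow> \<bar>v i - w i\<bar> \<le> D"
  shows "\<bar>w i - barycenter \<sigma> i\<bar> \<le> (1 - 1 / real K) * D"
proof -
  obtain xs ys where \<sigma>: "\<sigma> = xs @ w # ys" using split_list[OF assms(2)] by blast
  define l where "l = real (length \<sigma>)"
  have l: "0 < l" "l \<le> real K" using assms \<sigma> by (auto simp: l_def)
  have D0: "0 \<le> D" using D[OF assms(2,2)] by simp
  have "(\<Sum>v\<leftarrow>\<sigma>. v i - w i) = (\<Sum>v\<leftarrow>xs @ ys. v i - w i)" by (simp add: \<sigma>)
  also have "\<bar>\<dots>\<bar> \<le> real (length (xs @ ys)) * D"
    by (rule sum_list_abs_bound) (use assms(2) in \<open>auto intro!: D simp: \<sigma>\<close>)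
  also have "\<dots> = (l - 1) * D" by (simp add: \<sigma> l_def)
  finally have "\<bar>barycenter \<sigma> i - w i\<bar> \<le> (l - 1) * D / l"
    using l \<sigma> by (subst barycenter_diff) (auto simp: l_def divide_right_mono)
  also have "\<dots> = (1 - 1 / l) * D" using l by (simp add: field_simps)
  also have "\<dots> \<le> (1 - 1 / real K) * D"
    using l D0 by (intro mult_right_mono) (simp_all add: frac_le)
  finally show ?thesis by (simp add: abs_minus_commute)
qed

definition mesh_le :: "(nat \<Rightarrow> real) list \<Rightarrow> real \<Rightarrow> bool" where
  "mesh_le \<sigma> D \<longleftrightarrow> (\<forall>v \<in> set \<sigma>. \<forall>w \<in> set \<sigma>. \<forall>i. \<bar>v i - w i\<bar> \<le> D)"

text \<open>The mesh estimate for subdivision. \<open>K\<close> stays fixed while the induction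
  descends to faces, so that all of them get the same contraction factor.\<close>

lemma subdivide_nonzero:
  assumes "subdivide n \<phi> \<sigma> \<noteq> 0" "length \<sigma> = n" "n \<le> K" "set \<sigma> \<subseteq> C" "barycenter_closed C"
    "mesh_le \<sigma> D" "0 \<le> D"
  shows "\<exists>\<rho>. \<phi> \<rho> \<noteq> 0 \<and> length \<rho> = n \<and> set \<rho> \<subseteq> C \<and> mesh_le \<rho> ((1 - 1 / real K) * D)"
  using assms
proof (induction n arbitrary: \<phi> \<sigma> C)
  case 0
  then show ?case by (intro exI[of _ "[]"]) (simp add: mesh_le_def)
next
  case (Suc n)
  let ?b = "barycenter \<sigma>" and ?D = "(1 - 1 / real K) * D"
  \<comment> \<open>This box contains \<open>\<sigma>\<close> and is closed under barycenters;
    intersecting \<open>C\<close> with it makes the induction hypothesis keep all further vertices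
    within \<open>?D\<close> of the apex.\<close>
  let ?C = "C \<inter> {x. \<forall>i. \<bar>x i - ?b i\<bar> \<le> ?D}"
  have \<sigma>: "\<sigma> \<noteq> []" using Suc.prems by auto
  have "\<bar>v i - ?b i\<bar> \<le> ?D" if "v \<in> set \<sigma>" for v i
    using Suc.prems that by (intro barycenter_vertex_distance) (auto simp: mesh_le_def)
  then have C: "set \<sigma> \<subseteq> ?C" using Suc.prems by auto
  have Cc: "barycenter_closed ?C"
    using Suc.prems by (intro barycenter_closed_Int barycenter_closed_box)
  have D0: "0 \<le> ?D" using Suc.prems by simp
  have "coboundary \<sigma> (subdivide n (\<lambda>\<rho>. \<phi> (?b # \<rho>))) \<noteq> 0" using Suc.prems by simp
  then obtain \<tau> where \<tau>: "subdivide n (\<lambda>\<rho>. \<phi> (?b # \<rho>)) \<tau> \<noteq> 0" "set \<tau> \<subseteq> set \<sigma>"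
    "length \<sigma> = Suc (length \<tau>)" by (rule coboundary_nonzero)
  have "\<exists>\<rho>. \<phi> (?b # \<rho>) \<noteq> 0 \<and> length \<rho> = n \<and> set \<rho> \<subseteq> ?C \<and> mesh_le \<rho> ?D"
    by (rule Suc.IH[OF \<tau>(1)]) (use Suc.prems \<tau> C Cc in \<open>auto simp: mesh_le_def\<close>)
  then obtain \<rho> where \<rho>: "\<phi> (?b # \<rho>) \<noteq> 0" "length \<rho> = n" "set \<rho> \<subseteq> ?C" "mesh_le \<rho> ?D"
    by blast
  have "?b \<in> C" using barycenter_closedD[OF Suc.prems(5) \<sigma>] Suc.prems by blast
  moreover have "mesh_le (?b # \<rho>) ?D"
    using \<rho>(3,4) D0 by (auto simp: mesh_le_def abs_minus_commute subset_iff)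
  ultimately show ?case using \<rho> by (intro exI[of _ "?b # \<rho>"]) auto
qed

definition subdivide_iter ::
  "nat \<Rightarrow> nat \<Rightarrow> ((nat \<Rightarrow> real) list \<Rightarrow> bit) \<Rightarrow> (nat \<Rightarrow> real) list \<Rightarrow> bit" where
  "subdivide_iter N n = subdivide n ^^ N"

lemma subdivide_iter_0 [simp]: "subdivide_iter 0 n \<phi> = \<phi>"
  by (simp add: subdivide_iter_def)

lemma subdivide_iter_Suc [simp]:
  "subdivide_iter (Suc N) n \<phi> = subdivide n (subdivide_iter N n \<phi>)"
  by (simp add: subdivide_iter_def)

lemma subdivide_iter_add:
  "subdivide_iter N n (\<lambda>\<tau>. \<phi> \<tau> + \<psi> \<tau>) =
     (\<lambda>\<sigma>. subdivide_iter N n \<phi> \<sigma> + subdivide_iter N n \<psi> \<sigma>)"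
proof (induction N)
  case (Suc N)
  show ?case by (simp only: subdivide_iter_Suc Suc) (rule subdivide_add)
qed simp

lemma subdivide_iter_coboundary:
  "length \<sigma> = Suc n \<Longrightarrow>
     subdivide_iter N (Suc n) (\<lambda>\<tau>. coboundary \<tau> \<phi>) \<sigma> = coboundary \<sigma> (subdivide_iter N n \<phi>)"
proof (induction N arbitrary: \<sigma>)
  case (Suc N)
  then have "subdivide_iter (Suc N) (Suc n) (\<lambda>\<tau>. coboundary \<tau> \<phi>) \<sigma> =
      subdivide (Suc n) (\<lambda>\<tau>. coboundary \<tau> (subdivide_iter N n \<phi>)) \<sigma>"
    by (simp only: subdivide_iter_Suc) (rule subdivide_cong, simp_all)
  also have "\<dots> = coboundary \<sigma> (subdivide_iter (Suc N) n \<phi>)"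
    using Suc by (simp only: subdivide_coboundary subdivide_iter_Suc)
  finally show ?case .
qed simp

lemma subdivide_iter_antipode:
  "subdivide_iter N n (\<lambda>\<tau>. \<phi> (map antipode \<tau>)) =
     (\<lambda>\<sigma>. subdivide_iter N n \<phi> (map antipode \<sigma>))"
proof (induction N)
  case (Suc N)
  show ?case by (simp only: subdivide_iter_Suc Suc) (rule subdivide_antipode)
qed simp

lemma subdivide_iter_nonzero:
  assumes "subdivide_iter N n \<phi> \<sigma> \<noteq> 0" "length \<sigma> = n" "set \<sigma> \<subseteq> C" "barycenter_closed C"
    "mesh_le \<sigma> D" "0 \<le> D"
  shows "\<exists>\<rho>. \<phi> \<rho> \<noteq> 0 \<and> length \<rho> = n \<and> set \<rho> \<subseteq> C \<and> mesh_le \<rho> ((1 - 1 / real n) ^ N * D)"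
  using assms
proof (induction N arbitrary: \<sigma> D)
  case (Suc N)
  let ?q = "1 - 1 / real n"
  have q: "0 \<le> ?q" by (cases n) simp_all
  from subdivide_nonzero[of n "subdivide_iter N n \<phi>" \<sigma> n C D] Suc.prems obtain \<rho> where
    \<rho>: "subdivide_iter N n \<phi> \<rho> \<noteq> 0" "length \<rho> = n" "set \<rho> \<subseteq> C" "mesh_le \<rho> (?q * D)"
    by auto
  have "0 \<le> ?q * D" using q Suc.prems(6) by simp
  from Suc.IH[OF \<rho>(1-3) Suc.prems(4) \<rho>(4) this] show ?case
    by (simp only: power_Suc2 mult.assoc)
qed auto

section \<open>Hemispheres of octahedral spheres\<close>

definition unit_vector :: "nat \<Rightarrow> nat \<Rightarrow> real" where
  "unit_vector j = (\<lambda>i. if i = j then 1 else 0)"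

text \<open>
  The sum of \<open>\<phi>\<close> over a hemisphere of the \<open>j\<close>-dimensional octahedral sphere: the cone with apex
  \<open>unit_vector j\<close> over the octahedral sphere of one dimension less, which is the union of its
  hemisphere and the antipode of that.
\<close>

primrec hemisphere :: "nat \<Rightarrow> ((nat \<Rightarrow> real) list \<Rightarrow> bit) \<Rightarrow> bit" where
  "hemisphere 0 \<phi> = \<phi> [unit_vector 0]"
| "hemisphere (Suc j) \<phi> =
     hemisphere j (\<lambda>\<tau>. \<phi> (unit_vector (Suc j) # \<tau>)) +
     hemisphere j (\<lambda>\<tau>. \<phi> (unit_vector (Suc j) # map antipode \<tau>))"

lemma hemisphere_add: "hemisphere j (\<lambda>\<tau>. \<phi> \<tau> + \<psi> \<tau>) = hemisphere j \<phi> + hemisphere j \<psi>"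
  by (induction j arbitrary: \<phi> \<psi>) (simp_all add: algebra_simps)

text \<open>A hemisphere is a cone over the equatorial sphere. Its boundary is that sphere plus the
  cone over the boundary of the sphere, and the latter is empty mod 2.\<close>

lemma hemisphere_coboundary:
  "hemisphere (Suc j) (\<lambda>\<tau>. coboundary \<tau> \<phi>) =
     hemisphere j \<phi> + hemisphere j (\<lambda>\<tau>. \<phi> (map antipode \<tau>))"
proof (induction j arbitrary: \<phi>)
  case 0
  show ?case by (simp add: algebra_simps)
next
  case (Suc j)
  let ?\<psi> = "\<lambda>\<tau>. \<phi> (unit_vector (Suc (Suc j)) # \<tau>)"
  \<comment> \<open>The two halves of the equatorial sphere have the same boundary, because the
    right side of the induction hypothesis is symmetric under the antipode; so the cones over these
    boundaries cancel.\<close>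
  have "hemisphere (Suc j) (\<lambda>\<tau>. coboundary \<tau> ?\<psi>) =
        hemisphere (Suc j) (\<lambda>\<tau>. coboundary (map antipode \<tau>) ?\<psi>)"
    by (simp only: coboundary_map Suc.IH map_antipode_antipode add.commute)
  then show ?case
    by (simp add: hemisphere.simps(2)[of "Suc j"] hemisphere_add algebra_simps del: hemisphere.simps map_map)
qed

text \<open>For a sign vector \<open>\<epsilon>\<close>, the facet of the octahedral sphere whose
  vertices are \<open>\<epsilon> i\<close> times the unit vectors, \<open>i \<le> j\<close>.\<close>

definition octant_face :: "(nat \<Rightarrow> real) \<Rightarrow> nat \<Rightarrow> (nat \<Rightarrow> real) set" where
  "octant_face \<epsilon> j = {x. (\<forall>i>j. x i = 0) \<and> (\<forall>i. 0 \<le> \<epsilon> i * x i) \<and> (\<Sum>i\<le>j. \<epsilon> i * x i) = 1}"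

definition sign_vector :: "(nat \<Rightarrow> real) \<Rightarrow> bool" where
  "sign_vector \<epsilon> \<longleftrightarrow> (\<forall>i. \<epsilon> i = 1 \<or> \<epsilon> i = -1)"

lemma octant_face_Suc: "x \<in> octant_face \<epsilon> j \<Longrightarrow> x \<in> octant_face (\<epsilon>(Suc j := 1)) (Suc j)"
  by (auto simp: octant_face_def intro: sum.cong)

lemma octant_face_antipode: "x \<in> octant_face \<epsilon> j \<Longrightarrow> antipode x \<in> octant_face (\<lambda>i. - \<epsilon> i) j"
  by (auto simp: octant_face_def antipode_apply)

lemma unit_vector_octant_face: "unit_vector j \<in> octant_face (\<epsilon>(j := 1)) j"
  by (auto simp: octant_face_def unit_vector_def if_distrib cong: if_cong)

text \<open>The common facet matters because the whole sphere is not closed under barycenters: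
  within one facet, subdivision neither leaves the sphere nor produces the zero vector.\<close>

lemma hemisphere_nonzero:
  assumes "hemisphere j \<phi> \<noteq> 0"
  shows "\<exists>\<tau> \<epsilon>. \<phi> \<tau> \<noteq> 0 \<and> length \<tau> = Suc j \<and> sign_vector \<epsilon> \<and> set \<tau> \<subseteq> octant_face \<epsilon> j"
  using assms
proof (induction j arbitrary: \<phi>)
  case 0
  then show ?case
    using unit_vector_octant_face[of 0 "\<lambda>_. 1"]
    by (intro exI[of _ "[unit_vector 0]"] exI[of _ "\<lambda>_. 1"]) (auto simp: sign_vector_def fun_upd_def)
next
  case (Suc j)
  let ?e = "unit_vector (Suc j)"
  have "\<exists>\<tau> \<epsilon>. \<phi> (?e # \<tau>) \<noteq> 0 \<and> length \<tau> = Suc j \<and> sign_vector \<epsilon> \<and> set \<tau> \<subseteq> octant_face \<epsilon> j"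
  proof (cases "hemisphere j (\<lambda>\<tau>. \<phi> (?e # \<tau>)) = 0")
    case True
    then have "hemisphere j (\<lambda>\<tau>. \<phi> (?e # map antipode \<tau>)) \<noteq> 0" using Suc.prems by simp
    from Suc.IH[OF this] obtain \<tau> \<epsilon> where
      "\<phi> (?e # map antipode \<tau>) \<noteq> 0" "length \<tau> = Suc j" "sign_vector \<epsilon>" "set \<tau> \<subseteq> octant_face \<epsilon> j"
      by blast
    then show ?thesis
      by (intro exI[of _ "map antipode \<tau>"] exI[of _ "\<lambda>i. - \<epsilon> i"])
         (auto simp: sign_vector_def octant_face_antipode)
  next
    case False
    from Suc.IH[OF this] show ?thesis by blast
  qed
  then obtain \<tau> \<epsilon> where
    "\<phi> (?e # \<tau>) \<noteq> 0" "length \<tau> = Suc j" "sign_vector \<epsilon>" "set \<tau> \<subseteq> octant_face \<epsilon> j"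
    by blast
  moreover from \<open>sign_vector \<epsilon>\<close> have "sign_vector (\<epsilon>(Suc j := 1))"
    by (simp add: sign_vector_def)
  ultimately show ?case
    using unit_vector_octant_face[of "Suc j" \<epsilon>]
    by (intro exI[of _ "?e # \<tau>"] exI[of _ "\<epsilon>(Suc j := 1)"])
       (auto simp: octant_face_Suc simp del: fun_upd_apply)
qed

lemma barycenter_closed_octant_face: "barycenter_closed (octant_face \<epsilon> j)"
  unfolding barycenter_closed_def
proof (intro allI impI)
  fix \<sigma> assume ne: "\<sigma> \<noteq> []" and \<sigma>: "set \<sigma> \<subseteq> octant_face \<epsilon> j"
  have "(\<Sum>v\<leftarrow>\<sigma>. v i) = 0" if "i > j" for i
    using \<sigma> that by (induction \<sigma>) (auto simp: octant_face_def)
  moreover have "0 \<le> \<epsilon> i * (\<Sum>v\<leftarrow>\<sigma>. v i)" for i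
    using \<sigma> by (induction \<sigma>) (auto simp: octant_face_def algebra_simps)
  moreover have "(\<Sum>i\<le>j. \<epsilon> i * (\<Sum>v\<leftarrow>\<sigma>. v i)) = real (length \<sigma>)"
    using \<sigma> by (induction \<sigma>) (auto simp: octant_face_def algebra_simps sum.distrib)
  ultimately show "barycenter \<sigma> \<in> octant_face \<epsilon> j"
    using ne by (auto simp: octant_face_def barycenter_def simp flip: sum_divide_distrib)
qed

lemma octant_face_abs_le:
  assumes "x \<in> octant_face \<epsilon> j" "sign_vector \<epsilon>"
  shows "\<bar>x i\<bar> \<le> 1"
proof (cases "i \<le> j")
  case True
  have "\<epsilon> i * x i \<le> (\<Sum>i\<le>j. \<epsilon> i * x i)"
    by (rule member_le_sum) (use assms True in \<open>auto simp: octant_face_def\<close>)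
  then have "\<epsilon> i * x i \<le> 1" "0 \<le> \<epsilon> i * x i" using assms by (auto simp: octant_face_def)
  then show ?thesis using assms(2)[unfolded sign_vector_def, rule_format, of i] by auto
qed (use assms in \<open>auto simp: octant_face_def\<close>)

lemma octant_face_nonzero: "x \<in> octant_face \<epsilon> j \<Longrightarrow> x \<noteq> (\<lambda>i. 0)"
  by (auto simp: octant_face_def)

lemma hemisphere_subdivide_iter_nonzero:
  assumes "hemisphere j (subdivide_iter N (Suc j) \<phi>) \<noteq> 0"
  shows "\<exists>\<rho> \<epsilon>. \<phi> \<rho> \<noteq> 0 \<and> length \<rho> = Suc j \<and> sign_vector \<epsilon> \<and> set \<rho> \<subseteq> octant_face \<epsilon> j \<and>
           mesh_le \<rho> ((1 - 1 / real (Suc j)) ^ N * 2)"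
proof -
  obtain \<tau> \<epsilon> where \<tau>: "subdivide_iter N (Suc j) \<phi> \<tau> \<noteq> 0" "length \<tau> = Suc j" "sign_vector \<epsilon>"
    "set \<tau> \<subseteq> octant_face \<epsilon> j"
    using hemisphere_nonzero[OF assms] by blast
  have "\<bar>v i - w i\<bar> \<le> 2" if "v \<in> set \<tau>" "w \<in> set \<tau>" for v w i
    using octant_face_abs_le[of v \<epsilon> j i] octant_face_abs_le[of w \<epsilon> j i] \<tau> that by fastforce
  then have "mesh_le \<tau> 2" by (auto simp: mesh_le_def)
  from subdivide_iter_nonzero[OF \<tau>(1,2,4) barycenter_closed_octant_face this] \<tau>(3)
  show ?thesis by auto
qed

text \<open>If the two values differed, the sum of the cochains would be nonzero on some simplex of
  the subdivided hemisphere, whose vertices lie in a facet and so avoid the zero vector.\<close>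

lemma hemisphere_subdivide_iter_cong:
  assumes "\<And>\<rho>. length \<rho> = Suc j \<Longrightarrow> (\<lambda>i. 0) \<notin> set \<rho> \<Longrightarrow> \<phi> \<rho> = \<psi> \<rho>"
  shows "hemisphere j (subdivide_iter N (Suc j) \<phi>) = hemisphere j (subdivide_iter N (Suc j) \<psi>)"
proof (rule ccontr)
  assume "\<not> ?thesis"
  then have "hemisphere j (subdivide_iter N (Suc j) (\<lambda>\<rho>. \<phi> \<rho> + \<psi> \<rho>)) \<noteq> 0"
    by (simp add: subdivide_iter_add hemisphere_add add_eq_0_iff)
  from hemisphere_subdivide_iter_nonzero[OF this] obtain \<rho> \<epsilon> where
    "\<phi> \<rho> + \<psi> \<rho> \<noteq> 0" "length \<rho> = Suc j" "set \<rho> \<subseteq> octant_face \<epsilon> j" by blast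
  moreover from this have "(\<lambda>i. 0) \<notin> set \<rho>" using octant_face_nonzero by blast
  ultimately show False using assms[of \<rho>] by simp
qed

section \<open>Cup products of sign cochains\<close>

text \<open>
  The cup product of the coboundaries of the 0-cochains in the list. For the signs of \<open>j\<close> odd
  functions it represents the top power of the generator of the cohomology of projective space.
\<close>

fun sign_change :: "('a \<Rightarrow> bit) list \<Rightarrow> 'a list \<Rightarrow> bit" where
  "sign_change (s # ss) (v # w # \<sigma>) = (s v + s w) * sign_change ss (w # \<sigma>)"
| "sign_change _ _ = 1"

text \<open>The cup product of the 0-cochain \<open>s\<close> with the cocycle
  \<open>sign_change ss\<close>.\<close>

definition sign_primitive :: "('a \<Rightarrow> bit) \<Rightarrow> ('a \<Rightarrow> bit) list \<Rightarrow> 'a list \<Rightarrow> bit" where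
  "sign_primitive s ss \<sigma> = s (hd \<sigma>) * sign_change ss \<sigma>"

text \<open>The two claims need each other. By the second, \<open>sign_change (t # ss)\<close> is a
  coboundary, hence a cocycle; and for a cocycle \<open>z\<close> the Leibniz rule makes the
  coboundary of the cup product of \<open>s\<close> and \<open>z\<close> the product of the
  coboundary of \<open>s\<close> with \<open>z\<close>.\<close>

lemma coboundary_sign_change:
  "length \<sigma> = Suc (Suc (length ss)) \<Longrightarrow> coboundary \<sigma> (sign_change ss) = 0"
  "length \<sigma> = Suc (Suc (length ss)) \<Longrightarrow>
     coboundary \<sigma> (sign_primitive s ss) = sign_change (s # ss) \<sigma>"
proof (induction ss arbitrary: s \<sigma>)
  case Nil
  {
    case 1
    then show ?case by (auto simp: length_Suc_conv)
  next
    case 2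
    then show ?case by (auto simp: length_Suc_conv sign_primitive_def algebra_simps)
  }
next
  case (Cons t ss)
  {
    case 1
    have "coboundary \<sigma> (sign_change (t # ss)) =
          coboundary \<sigma> (\<lambda>\<tau>. coboundary \<tau> (sign_primitive t ss))"
      using 1 by (intro coboundary_cong) (simp add: Cons.IH(2))
    then show ?case by (simp add: coboundary_coboundary)
  }
  note cocycle = this
  {
    case 2
    then obtain v w \<sigma>' where \<sigma>: "\<sigma> = v # w # \<sigma>'" by (auto simp: length_Suc_conv)
    \<comment> \<open>The cocycle identity, split at \<open>v\<close>: the faces containing
      \<open>v\<close> together give the same value as the face opposite \<open>v\<close>. In the
      goal the former carry the factor \<open>s v\<close>, the latter the factor
      \<open>s w\<close>.\<close>
    have "sign_change (t # ss) (w # \<sigma>') + coboundary (w # \<sigma>') (\<lambda>\<tau>. sign_change (t # ss) (v # \<tau>)) = 0"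
      using cocycle[of \<sigma>] 2 by (simp only: \<sigma> coboundary.simps)
    then have "coboundary (w # \<sigma>') (\<lambda>\<tau>. sign_change (t # ss) (v # \<tau>)) = sign_change (t # ss) (w # \<sigma>')"
      by (metis add.right_neutral bit_add_self_left)
    then show ?case
      unfolding \<sigma> sign_primitive_def
      by (simp only: coboundary.simps(2)[of v] coboundary_mult list.sel sign_change.simps(1)[of s])
         (simp add: algebra_simps)
  }
qed

lemma sign_change_antipode:
  assumes "\<And>s v. s \<in> set ss \<Longrightarrow> v \<noteq> (\<lambda>i. 0) \<Longrightarrow> s (antipode v) = s v + 1"
  shows "(\<lambda>i. 0) \<notin> set \<sigma> \<Longrightarrow> sign_change ss (map antipode \<sigma>) = sign_change ss \<sigma>"
  using assms
proof (induction ss \<sigma> rule: sign_change.induct)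
  case (1 s ss v w \<sigma>)
  have "s (antipode v) = s v + 1" "s (antipode w) = s w + 1"
    by (rule 1(3); use 1(2) in auto)+
  then have "s (antipode v) + s (antipode w) = s v + s w"
    by (simp add: algebra_simps)
  moreover have "sign_change ss (map antipode (w # \<sigma>)) = sign_change ss (w # \<sigma>)"
    by (rule 1(1); (rule 1(3))?; use 1(2) in auto)
  ultimately show ?case by simp
qed simp_all

text \<open>Induction on the dimension by Stokes. As \<open>sign_change (s # ss)\<close> is the
  coboundary of \<open>sign_primitive s ss\<close>, its sum is a sum over the equatorial sphere.
  There a simplex with first vertex \<open>v\<close> and its antipode contribute
  \<open>s v + s (antipode v) = 1\<close> times \<open>sign_change ss\<close>, which leaves the sum
  over a hemisphere of one dimension less.\<close>

lemma hemisphere_sign_change: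
  assumes "\<And>s v. s \<in> set ss \<Longrightarrow> v \<noteq> (\<lambda>i. 0) \<Longrightarrow> s (antipode v) = s v + 1"
  shows "hemisphere (length ss) (subdivide_iter N (Suc (length ss)) (sign_change ss)) = 1"
  using assms
proof (induction ss)
  case Nil
  have "subdivide_iter N (Suc 0) (\<lambda>_. 1) \<sigma> = 1" if "length \<sigma> = Suc 0" for \<sigma>
    using that
  proof (induction N arbitrary: \<sigma>)
    case (Suc N)
    then show ?case by (auto simp: length_Suc_conv)
  qed simp
  moreover have "sign_change [] = (\<lambda>_::(nat \<Rightarrow> real) list. 1)" by (rule ext) simp
  ultimately show ?case by simp
next
  case (Cons s ss)
  let ?j = "length ss" and ?\<alpha> = "sign_primitive s ss"
  have "hemisphere (Suc ?j) (subdivide_iter N (Suc (Suc ?j)) (sign_change (s # ss))) =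
        hemisphere (Suc ?j) (subdivide_iter N (Suc (Suc ?j)) (\<lambda>\<tau>. coboundary \<tau> ?\<alpha>))"
    by (rule hemisphere_subdivide_iter_cong) (simp add: coboundary_sign_change(2))
  \<comment> \<open>With \<open>N = 0\<close> the congruence supplies the length that
    \<open>subdivide_iter_coboundary\<close> asks for.\<close>
  also have "\<dots> = hemisphere (Suc ?j) (\<lambda>\<sigma>. coboundary \<sigma> (subdivide_iter N (Suc ?j) ?\<alpha>))"
    by (rule hemisphere_subdivide_iter_cong[where N = 0, unfolded subdivide_iter_0])
       (simp only: subdivide_iter_coboundary)
  also have "\<dots> = hemisphere ?j (subdivide_iter N (Suc ?j) (\<lambda>\<sigma>. ?\<alpha> \<sigma> + ?\<alpha> (map antipode \<sigma>)))"
    by (simp only: hemisphere_coboundary subdivide_iter_add subdivide_iter_antipode hemisphere_add)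
  also have "\<dots> = hemisphere ?j (subdivide_iter N (Suc ?j) (sign_change ss))"
  proof (rule hemisphere_subdivide_iter_cong)
    fix \<rho> :: "(nat \<Rightarrow> real) list"
    assume \<rho>: "length \<rho> = Suc ?j" "(\<lambda>i. 0) \<notin> set \<rho>"
    then obtain v \<sigma> where v: "\<rho> = v # \<sigma>" by (cases \<rho>) auto
    have "sign_change ss (map antipode \<rho>) = sign_change ss \<rho>"
      using \<rho> Cons.prems by (intro sign_change_antipode) auto
    moreover have "s (antipode v) = s v + 1" using \<rho> v Cons.prems by auto
    ultimately show "?\<alpha> \<rho> + ?\<alpha> (map antipode \<rho>) = sign_change ss \<rho>"
      by (simp add: v sign_primitive_def algebra_simps)
  qed
  also have "\<dots> = 1" using Cons by auto
  finally show ?case by simp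
qed

lemma sign_change_nonzero:
  assumes "sign_change ss \<sigma> \<noteq> 0" "length \<sigma> = Suc (length ss)" "s \<in> set ss"
  shows "\<exists>v\<in>set \<sigma>. \<exists>w\<in>set \<sigma>. s v \<noteq> s w"
  using assms
proof (induction ss \<sigma> rule: sign_change.induct)
  case (1 s' ss v w \<sigma>)
  then have "s' v \<noteq> s' w" by auto
  moreover have "\<exists>v\<in>set (w # \<sigma>). \<exists>w'\<in>set (w # \<sigma>). s v \<noteq> s w'" if "s \<noteq> s'"
    by (rule 1(1)) (use 1(2-4) that in simp_all)
  moreover have "set (w # \<sigma>) \<subseteq> set (v # w # \<sigma>)" "v \<in> set (v # w # \<sigma>)" "w \<in> set (v # w # \<sigma>)" by auto
  ultimately show ?case by blast
qed simp_all

section \<open>The Borsuk-Ulam theorem\<close>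

definition octahedral_sphere :: "nat \<Rightarrow> (nat \<Rightarrow> real) set" where
  "octahedral_sphere d = {x. (\<forall>i>d. x i = 0) \<and> (\<Sum>i\<le>d. \<bar>x i\<bar>) = 1}"

lemma octant_face_subset_octahedral_sphere:
  assumes "sign_vector \<epsilon>"
  shows "octant_face \<epsilon> d \<subseteq> octahedral_sphere d"
proof
  fix x assume x: "x \<in> octant_face \<epsilon> d"
  have "\<bar>x i\<bar> = \<epsilon> i * x i" for i
  proof -
    have "0 \<le> \<epsilon> i * x i" using x by (auto simp: octant_face_def)
    then show ?thesis using assms[unfolded sign_vector_def, rule_format, of i] by auto
  qed
  then show "x \<in> octahedral_sphere d" using x by (auto simp: octant_face_def octahedral_sphere_def)
qed

lemma antipode_octahedral_sphere [simp]: "antipode x \<in> octahedral_sphere d \<longleftrightarrow> x \<in> octahedral_sphere d"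
  by (simp add: octahedral_sphere_def antipode_apply)

lemma octahedral_sphere_abs_le: 
  assumes "x \<in> octahedral_sphere d"
  shows "\<bar>x i\<bar> \<le> 1"
proof (cases "i \<le> d")
  case True
  then have "\<bar>x i\<bar> \<le> (\<Sum>i\<le>d. \<bar>x i\<bar>)" by (intro member_le_sum) auto
  then show ?thesis using assms by (simp add: octahedral_sphere_def)
qed (use assms in \<open>auto simp: octahedral_sphere_def\<close>)

lemma tendsto_fun_iff:
  fixes f :: "'a \<Rightarrow> 'b \<Rightarrow> 'c::topological_space"
  shows "(f \<longlongrightarrow> l) F \<longleftrightarrow> (\<forall>i. ((\<lambda>x. f x i) \<longlongrightarrow> l i) F)"
  by (simp add: limitin_componentwise extensional_def
        flip: limitin_canonical_iff euclidean_product_topology)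

lemma compact_box_fun: "compact {x::nat \<Rightarrow> real. \<forall>i. a i \<le> x i \<and> x i \<le> b i}"
proof -
  have "compactin (product_topology (\<lambda>i::nat. euclidean) UNIV) (\<Pi>\<^sub>E i\<in>UNIV. {a i..b i})"
    by (subst compactin_PiE) auto
  moreover have "(\<Pi>\<^sub>E i\<in>UNIV. {a i..b i}) = {x. \<forall>i. a i \<le> x i \<and> x i \<le> b i}"
    by (auto simp: PiE_def Pi_def)
  ultimately show ?thesis by (simp add: euclidean_product_topology)
qed

lemma compact_octahedral_sphere: "compact (octahedral_sphere d)"
proof -
  have "closed (octahedral_sphere d)"
    unfolding octahedral_sphere_def
    by (intro closed_Collect_conj closed_Collect_all closed_Collect_imp closed_Collect_eq
          open_Collect_const continuous_on_sum continuous_on_rabs continuous_on_const)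
       (rule continuous_on_product_coordinates)+
  moreover have "octahedral_sphere d \<subseteq> {x. \<forall>i. -1 \<le> x i \<and> x i \<le> 1}"
    using octahedral_sphere_abs_le[of _ d, unfolded abs_le_iff] by (simp add: subset_iff minus_le_iff)
  ultimately show ?thesis
    using compact_Int_closed[OF compact_box_fun[of "\<lambda>_. -1" "\<lambda>_. 1"], of "octahedral_sphere d"]
    by (simp only: inf.absorb2)
qed

text \<open>A choice of one point from each antipodal pair of nonzero vectors.\<close>

definition leading_positive :: "(nat \<Rightarrow> real) \<Rightarrow> bool" where
  "leading_positive v \<longleftrightarrow> v (LEAST i. v i \<noteq> 0) > 0"

lemma leading_positive_antipode:
  assumes "v \<noteq> (\<lambda>i. 0)"
  shows "leading_positive (antipode v) \<longleftrightarrow> \<not> leading_positive v"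
proof -
  from assms obtain i where "v i \<noteq> 0" by auto
  then have "v (LEAST i. v i \<noteq> 0) \<noteq> 0" by (rule LeastI)
  then show ?thesis by (auto simp: leading_positive_def antipode_apply)
qed

text \<open>Ties \<open>f v = 0\<close> are broken so that antipodal points never get the same sign.\<close>

definition odd_sign :: "((nat \<Rightarrow> real) \<Rightarrow> real) \<Rightarrow> (nat \<Rightarrow> real) \<Rightarrow> bit" where
  "odd_sign f v = of_bool (f v > 0 \<or> f v = 0 \<and> leading_positive v)"

lemma odd_sign_antipode:
  assumes "v \<noteq> (\<lambda>i. 0)" "f (antipode v) = - f v"
  shows "odd_sign f (antipode v) = odd_sign f v + 1"
  using assms by (auto simp: odd_sign_def leading_positive_antipode)

lemma odd_sign_differs:
  assumes "odd_sign f v \<noteq> odd_sign f w"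
  shows "f v \<ge> 0 \<and> f w \<le> 0 \<or> f w \<ge> 0 \<and> f v \<le> 0"
  using assms by (auto simp: odd_sign_def of_bool_def split: if_splits)

text \<open>The sum in \<open>hemisphere_sign_change\<close> is 1, so some simplex of the
  subdivision has a nonzero product of sign changes, and every \<open>F i\<close> changes sign along
  one of its edges.\<close>

lemma odd_maps_small_simplex:
  fixes F :: "nat \<Rightarrow> (nat \<Rightarrow> real) \<Rightarrow> real"
  assumes odd: "\<And>i x. i < d \<Longrightarrow> x \<in> octahedral_sphere d \<Longrightarrow> F i (antipode x) = - F i x"
  shows "\<exists>\<rho>. \<rho> \<noteq> [] \<and> set \<rho> \<subseteq> octahedral_sphere d \<and> mesh_le \<rho> ((1 - 1 / real (Suc d)) ^ N * 2) \<and>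
           (\<forall>i<d. \<exists>v\<in>set \<rho>. \<exists>w\<in>set \<rho>. F i v \<ge> 0 \<and> F i w \<le> 0)"
proof -
  \<comment> \<open>Extension by 0 makes the functions odd everywhere, since
    \<open>hemisphere_sign_change\<close> asks for antipodal signs at all nonzero vectors, not only
    on the sphere.\<close>
  define G where "G i x = (if x \<in> octahedral_sphere d then F i x else 0)" for i x
  define ss where "ss = map (\<lambda>i. odd_sign (G i)) [0..<d]"
  have len: "length ss = d" by (simp add: ss_def)
  have "hemisphere (length ss) (subdivide_iter N (Suc (length ss)) (sign_change ss)) = 1"
  proof (rule hemisphere_sign_change)
    fix s and v :: "nat \<Rightarrow> real" assume "s \<in> set ss" and v: "v \<noteq> (\<lambda>i. 0)"
    then obtain i where i: "i < d" "s = odd_sign (G i)" by (auto simp: ss_def)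
    have "G i (antipode v) = - G i v" using odd[OF i(1)] by (simp add: G_def)
    then show "s (antipode v) = s v + 1" unfolding i(2) by (rule odd_sign_antipode[OF v])
  qed
  then have "hemisphere d (subdivide_iter N (Suc d) (sign_change ss)) \<noteq> 0" by (simp add: len)
  from hemisphere_subdivide_iter_nonzero[OF this] obtain \<rho> \<epsilon> where
    \<rho>: "sign_change ss \<rho> \<noteq> 0" "length \<rho> = Suc d" "sign_vector \<epsilon>" "set \<rho> \<subseteq> octant_face \<epsilon> d"
      "mesh_le \<rho> ((1 - 1 / real (Suc d)) ^ N * 2)" by blast
  have S: "set \<rho> \<subseteq> octahedral_sphere d"
    using \<rho> octant_face_subset_octahedral_sphere by blast
  have "\<exists>v\<in>set \<rho>. \<exists>w\<in>set \<rho>. F i v \<ge> 0 \<and> F i w \<le> 0" if i: "i < d" for i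
  proof -
    have "odd_sign (G i) \<in> set ss" using i by (auto simp: ss_def)
    moreover have "length \<rho> = Suc (length ss)" using \<rho>(2) len by simp
    ultimately obtain v w where
      vw: "v \<in> set \<rho>" "w \<in> set \<rho>" "odd_sign (G i) v \<noteq> odd_sign (G i) w"
      using sign_change_nonzero[OF \<rho>(1)] by blast
    have "G i v = F i v" "G i w = F i w" using vw S by (auto simp: G_def)
    then show ?thesis using odd_sign_differs[OF vw(3)] vw(1,2) by auto
  qed
  moreover have "\<rho> \<noteq> []" using \<rho>(2) by auto
  ultimately show ?thesis using S \<rho>(5) by blast
qed

text \<open>Simplices with mesh tending to 0 accumulate at some \<open>l\<close>; each
  \<open>F i\<close> takes weakly opposite signs arbitrarily near \<open>l\<close> and vanishes
  there by continuity.\<close>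

theorem Borsuk_Ulam_octahedral:
  fixes F :: "nat \<Rightarrow> (nat \<Rightarrow> real) \<Rightarrow> real"
  assumes cont: "\<And>i. i < d \<Longrightarrow> continuous_on (octahedral_sphere d) (F i)"
    and odd: "\<And>i x. i < d \<Longrightarrow> x \<in> octahedral_sphere d \<Longrightarrow> F i (antipode x) = - F i x"
  shows "\<exists>x \<in> octahedral_sphere d. \<forall>i<d. F i x = 0"
proof -
  let ?S = "octahedral_sphere d" and ?\<delta> = "\<lambda>N. (1 - 1 / real (Suc d)) ^ N * 2"
  have "\<forall>N. \<exists>\<rho>. \<rho> \<noteq> [] \<and> set \<rho> \<subseteq> ?S \<and> mesh_le \<rho> (?\<delta> N) \<and>
           (\<forall>i<d. \<exists>v\<in>set \<rho>. \<exists>w\<in>set \<rho>. F i v \<ge> 0 \<and> F i w \<le> 0)"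
    by (rule allI, rule odd_maps_small_simplex, rule odd)
  from choice[OF this] obtain \<rho> where \<rho>: "\<And>N. \<rho> N \<noteq> []" "\<And>N. set (\<rho> N) \<subseteq> ?S" "\<And>N. mesh_le (\<rho> N) (?\<delta> N)"
    "\<And>N i. i < d \<Longrightarrow> \<exists>v\<in>set (\<rho> N). \<exists>w\<in>set (\<rho> N). F i v \<ge> 0 \<and> F i w \<le> 0" by blast
  have hd: "hd (\<rho> N) \<in> set (\<rho> N)" for N using \<rho>(1) by simp
  then have hdS: "\<forall>N. hd (\<rho> N) \<in> ?S" using \<rho>(2) by blast
  have "seq_compact ?S" by (rule compact_imp_seq_compact[OF compact_octahedral_sphere])
  from seq_compactE[OF this hdS] obtain l r where
    l: "l \<in> ?S" "strict_mono r" "((\<lambda>N. hd (\<rho> N)) \<circ> r) \<longlonglongrightarrow> l" .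
  have \<delta>: "?\<delta> \<longlonglongrightarrow> 0"
    by (rule tendsto_mult_left_zero, rule LIMSEQ_realpow_zero) simp_all
  \<comment> \<open>As the mesh tends to 0, every choice of vertices has the same limit along the
    same subsequence.\<close>
  have conv: "(\<lambda>N. v (r N)) \<longlonglongrightarrow> l" if v: "\<And>N. v N \<in> set (\<rho> N)" for v
    unfolding tendsto_fun_iff
  proof
    fix i
    have "(\<lambda>N. v N i - hd (\<rho> N) i) \<longlonglongrightarrow> 0"
      by (rule Lim_null_comparison[OF _ \<delta>])
         (use \<rho>(3)[unfolded mesh_le_def] v hd in \<open>simp add: real_norm_def\<close>)
    from LIMSEQ_subseq_LIMSEQ[OF this l(2)]
    have "(\<lambda>N. v (r N) i - hd (\<rho> (r N)) i) \<longlonglongrightarrow> 0"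
      by (simp only: o_def)
    moreover have "(\<lambda>N. hd (\<rho> (r N)) i) \<longlonglongrightarrow> l i"
      using l(3) by (simp add: tendsto_fun_iff o_def)
    ultimately have "(\<lambda>N. (v (r N) i - hd (\<rho> (r N)) i) + hd (\<rho> (r N)) i) \<longlonglongrightarrow> 0 + l i"
      by (rule tendsto_add)
    then show "(\<lambda>N. v (r N) i) \<longlonglongrightarrow> l i" by simp
  qed
  have "F i l = 0" if i: "i < d" for i
  proof -
    have "\<forall>N. \<exists>v. v \<in> set (\<rho> N) \<and> F i v \<ge> 0" using \<rho>(4)[OF i] by blast
    from choice[OF this] obtain v where v: "v N \<in> set (\<rho> N)" "F i (v N) \<ge> 0" for N by blast
    have "\<forall>N. \<exists>w. w \<in> set (\<rho> N) \<and> F i w \<le> 0" using \<rho>(4)[OF i] by blast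
    from choice[OF this] obtain w where w: "w N \<in> set (\<rho> N)" "F i (w N) \<le> 0" for N by blast
    have F: "(\<lambda>N. F i (u (r N))) \<longlonglongrightarrow> F i l" if u: "\<And>N. u N \<in> set (\<rho> N)" for u
    proof (rule continuous_on_tendsto_compose[OF cont[OF i] conv[OF u] l(1)])
      show "\<forall>\<^sub>F N in sequentially. u (r N) \<in> ?S" using \<rho>(2) u by (intro always_eventually) blast
    qed
    have "0 \<le> F i l" using v(2) by (intro LIMSEQ_le_const[OF F[OF v(1)]]) blast
    moreover have "F i l \<le> 0" using w(2) by (intro LIMSEQ_le_const2[OF F[OF w(1)]]) blast
    ultimately show ?thesis by simp
  qed
  then show ?thesis using l(1) by blast
qed

section \<open>The Cantor set and a membership test for the Menger set\<close>

text \<open>The integer \<open>c j\<close> consists of the first \<open>j\<close> ternary digits of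
  \<open>t\<close>, so that codes of coordinates combine to the codes in \<open>grid_cube\<close>.
  An end point of an interval may have two codes.\<close>

definition ternary_code :: "real \<Rightarrow> (nat \<Rightarrow> nat) \<Rightarrow> bool" where
  "ternary_code t c \<longleftrightarrow>
     c 0 = 0 \<and> (\<forall>j. c (Suc j) \<in> {3 * c j, 3 * c j + 1, 3 * c j + 2}) \<and>
     (\<forall>j. real (c j) / 3 ^ j \<le> t \<and> t \<le> (real (c j) + 1) / 3 ^ j)"

definition in_cantor_set :: "real \<Rightarrow> bool" where
  "in_cantor_set t \<longleftrightarrow> (\<exists>c. ternary_code t c \<and> (\<forall>j. c (Suc j) \<noteq> 3 * c j + 1))"

lemma ternary_code_exists:
  assumes "0 \<le> t" "t \<le> 1"
  shows "\<exists>c. ternary_code t c"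
proof -
  let ?P = "\<lambda>j a. real a / 3 ^ j \<le> t \<and> t \<le> (real a + 1) / 3 ^ j"
  have "\<exists>b. b \<in> {3 * a, 3 * a + 1, 3 * a + 2} \<and> ?P (Suc j) b" if "?P j a" for j a
  proof -
    define u where "u = 3 ^ Suc j * t"
    have u: "?P (Suc j) b \<longleftrightarrow> real b \<le> u \<and> u \<le> real b + 1" for b
      by (simp add: u_def field_simps)
    have "3 * real a \<le> u" "u \<le> 3 * real a + 3" using that by (simp_all add: u_def field_simps)
    then have "real (3 * a) \<le> u \<and> u \<le> real (3 * a) + 1 \<or>
       real (3 * a + 1) \<le> u \<and> u \<le> real (3 * a + 1) + 1 \<or>
       real (3 * a + 2) \<le> u \<and> u \<le> real (3 * a + 2) + 1" by (auto simp: not_le)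
    then show ?thesis unfolding u by blast
  qed
  moreover have "?P 0 0" using assms by simp
  ultimately have "\<exists>c. \<forall>j. (?P j (c j) \<and> (j = 0 \<longrightarrow> c j = 0)) \<and>
      c (Suc j) \<in> {3 * c j, 3 * c j + 1, 3 * c j + 2}"
    by (intro dependent_nat_choice) (blast, simp only: nat.simps simp_thms, blast)
  then show ?thesis unfolding ternary_code_def by blast
qed

text \<open>Prefixing the digit 0 moves each code to the next level unchanged.\<close>

lemma in_cantor_set_third: "in_cantor_set t \<Longrightarrow> in_cantor_set (t / 3)"
proof -
  assume "in_cantor_set t"
  then obtain c where c: "c 0 = 0" "\<And>j. c (Suc j) \<in> {3 * c j, 3 * c j + 1, 3 * c j + 2}"
    "\<And>j. real (c j) / 3 ^ j \<le> t \<and> t \<le> (real (c j) + 1) / 3 ^ j" "\<And>j. c (Suc j) \<noteq> 3 * c j + 1"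
    by (auto simp: in_cantor_set_def ternary_code_def)
  define d where "d = case_nat 0 c"
  have "d (Suc j) \<in> {3 * d j, 3 * d j + 1, 3 * d j + 2} \<and> d (Suc j) \<noteq> 3 * d j + 1" for j
    using c(1,2,4) by (cases j) (auto simp: d_def)
  moreover have "real (d j) / 3 ^ j \<le> t / 3 \<and> t / 3 \<le> (real (d j) + 1) / 3 ^ j" for j
  proof (cases j)
    case 0
    then show ?thesis using c(3)[of 0] c(1) by (simp add: d_def)
  next
    case (Suc k)
    then show ?thesis using c(3)[of k] by (simp add: d_def field_simps)
  qed
  ultimately show ?thesis
    unfolding in_cantor_set_def ternary_code_def by (intro exI[of _ d]) (auto simp: d_def)
qed

lemma in_cantor_set_two_thirds: "in_cantor_set t \<Longrightarrow> in_cantor_set ((t + 2) / 3)"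
proof -
  assume "in_cantor_set t"
  then obtain c where c: "c 0 = 0" "\<And>j. c (Suc j) \<in> {3 * c j, 3 * c j + 1, 3 * c j + 2}"
    "\<And>j. real (c j) / 3 ^ j \<le> t \<and> t \<le> (real (c j) + 1) / 3 ^ j" "\<And>j. c (Suc j) \<noteq> 3 * c j + 1"
    by (auto simp: in_cantor_set_def ternary_code_def)
  \<comment> \<open>Prefixing the digit 2 adds \<open>2 * 3 ^ j\<close> to the code of level
    \<open>j\<close> and moves it to level \<open>Suc j\<close>.\<close>
  define d where "d = case_nat 0 (\<lambda>j. c j + 2 * 3 ^ j)"
  have "d (Suc j) \<in> {3 * d j, 3 * d j + 1, 3 * d j + 2} \<and> d (Suc j) \<noteq> 3 * d j + 1" for j
    using c(1) c(2,4)[of "j - 1"] by (cases j) (auto simp: d_def)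
  moreover have "real (d j) / 3 ^ j \<le> (t + 2) / 3 \<and> (t + 2) / 3 \<le> (real (d j) + 1) / 3 ^ j" for j
  proof (cases j)
    case 0
    then show ?thesis using c(3)[of 0] c(1) by (simp add: d_def)
  next
    case (Suc k)
    then show ?thesis using c(3)[of k] by (simp add: d_def field_simps)
  qed
  ultimately show ?thesis
    unfolding in_cantor_set_def ternary_code_def by (intro exI[of _ d]) (auto simp: d_def)
qed

lemma in_cantor_set_0: "in_cantor_set 0"
  unfolding in_cantor_set_def ternary_code_def by (intro exI[of _ "\<lambda>_. 0"]) auto

text \<open>A finite ternary expansion with digits 0 and 2, built from the last digit upwards: each
  new index prefixes a digit, and \<open>L\<close> zeros are prefixed at the end.\<close>

lemma in_cantor_set_digits:
  "in_cantor_set (\<Sum>i<N. 2 * 3 ^ i / 3 ^ (N + L) * of_bool (i \<in> A))"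
proof -
  have shift: "in_cantor_set t \<Longrightarrow> in_cantor_set (t / 3 ^ L)" for t
    by (induction L) (auto dest: in_cantor_set_third simp: mult.commute)
  have "in_cantor_set (\<Sum>i<N. 2 * 3 ^ i / 3 ^ N * of_bool (i \<in> A))"
  proof (induction N)
    case (Suc N)
    let ?s = "\<Sum>i<N. 2 * 3 ^ i / 3 ^ N * of_bool (i \<in> A) :: real"
    have "(\<Sum>i<N. 2 * 3 ^ i / 3 ^ Suc N * of_bool (i \<in> A)) = ?s / 3"
      unfolding sum_divide_distrib by (rule sum.cong) simp_all
    then have eq: "(\<Sum>i<Suc N. 2 * 3 ^ i / 3 ^ Suc N * of_bool (i \<in> A)) =
          (?s + 2 * of_bool (N \<in> A)) / 3"
      by (simp only: sum.lessThan_Suc add_divide_distrib) simp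
    show ?case
      unfolding eq using in_cantor_set_third[OF Suc] in_cantor_set_two_thirds[OF Suc]
      by (cases "N \<in> A") simp_all
  qed (simp add: in_cantor_set_0)
  from shift[OF this] show ?thesis
    by (simp add: sum_divide_distrib power_add mult.commute)
qed

text \<open>A coordinate in the Cantor set never uses a middle third, so at every level it can be
  moved to an end of its interval within the next subinterval. The moved point has at most
  \<open>n\<close> coordinates strictly inside, hence lies in the skeleton and witnesses that the
  subcube is kept.\<close>

lemma menger_setI:
  assumes x: "\<And>i. i < m \<Longrightarrow> 0 \<le> x i \<and> x i \<le> 1" "\<And>i. m \<le> i \<Longrightarrow> x i = 0"
    and n: "card {i. i < m \<and> \<not> in_cantor_set (x i)} \<le> n"
  shows "x \<in> menger_set n m"
proof -
  have "\<exists>c. ternary_code (x i) c \<and> (in_cantor_set (x i) \<longrightarrow> (\<forall>j. c (Suc j) \<noteq> 3 * c j + 1))"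
    if "i < m" for i
    unfolding in_cantor_set_def using ternary_code_exists x(1)[OF that] by blast
  then have "\<forall>i. \<exists>c. i < m \<longrightarrow>
      ternary_code (x i) c \<and> (in_cantor_set (x i) \<longrightarrow> (\<forall>j. c (Suc j) \<noteq> 3 * c j + 1))"
    by blast
  from choice[OF this] obtain c where
    "\<forall>i<m. ternary_code (x i) (c i) \<and> (in_cantor_set (x i) \<longrightarrow> (\<forall>j. c i (Suc j) \<noteq> 3 * c i j + 1))"
    by blast
  then have c: "c i 0 = 0" "c i (Suc j) \<in> {3 * c i j, 3 * c i j + 1, 3 * c i j + 2}"
    "real (c i j) / 3 ^ j \<le> x i \<and> x i \<le> (real (c i j) + 1) / 3 ^ j"
    "in_cantor_set (x i) \<Longrightarrow> c i (Suc j) \<noteq> 3 * c i j + 1" if "i < m" for i j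
    using that by (simp_all add: ternary_code_def)
  \<comment> \<open>The entries from \<open>m\<close> on must be 0 at level 0, where the only code
    is the constant function 0.\<close>
  define a where "a j = (\<lambda>i. if i < m then c i j else 0)" for j
  have cube: "x \<in> grid_cube m j (a j)" for j
    unfolding grid_cube_def topspace_Euclidean_space a_def using c(3) x(2) by simp
  have "a j \<in> menger_cubes n m j" for j
  proof (induction j)
    case 0
    have "a 0 = (\<lambda>i. 0)" unfolding a_def by (rule ext) (simp add: c(1))
    then show ?case by simp
  next
    case (Suc j)
    \<comment> \<open>The next digit, 0 or 2, tells which end of the interval belongs to the chosen
      third; coordinates outside the Cantor set stay where they are.\<close>
    define y where "y = (\<lambda>i. if i < m \<and> in_cantor_set (x i)
        then (if c i (Suc j) = 3 * c i j then real (c i j) / 3 ^ j else (real (c i j) + 1) / 3 ^ j)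
        else x i)"
    have y_end: "y i = real (a j i) / 3 ^ j \<or> y i = (real (a j i) + 1) / 3 ^ j"
      if "i < m" "in_cantor_set (x i)" for i
      using that by (simp add: y_def a_def)
    have y0: "y \<in> topspace (Euclidean_space m)"
      using x(2) by (simp add: y_def topspace_Euclidean_space)
    have yj: "y \<in> grid_cube m j (a j)"
      unfolding grid_cube_def
    proof (intro CollectI conjI allI impI)
      fix i assume i: "i < m"
      have "real (c i j) / 3 ^ j \<le> (real (c i j) + 1) / 3 ^ j" by (simp add: divide_right_mono)
      with i c(3)[OF i, of j] show "real (a j i) / 3 ^ j \<le> y i" "y i \<le> (real (a j i) + 1) / 3 ^ j"
        by (simp_all add: y_def a_def)
    qed (rule y0)
    have "card {i. i < m \<and> y i \<noteq> real (a j i) / 3 ^ j \<and> y i \<noteq> (real (a j i) + 1) / 3 ^ j} \<le>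
          card {i. i < m \<and> \<not> in_cantor_set (x i)}"
      using y_end by (intro card_mono) (simp, blast)
    then have "card {i. i < m \<and> y i \<noteq> real (a j i) / 3 ^ j \<and> y i \<noteq> (real (a j i) + 1) / 3 ^ j} \<le> n"
      using n by (rule le_trans)
    then have "y \<in> cube_skeleton n m j (a j)" using yj by (simp add: cube_skeleton_def)
    moreover have "real (a (Suc j) i) / 3 ^ Suc j \<le> y i \<and> y i \<le> (real (a (Suc j) i) + 1) / 3 ^ Suc j"
      if i: "i < m" for i
    proof (cases "in_cantor_set (x i)")
      case True
      then have "c i (Suc j) = 3 * c i j \<or> c i (Suc j) = 3 * c i j + 2"
        using c(2,4)[OF i, of j] by auto
      then show ?thesis
      proof
        assume "c i (Suc j) = 3 * c i j"
        then show ?thesis using i True by (simp add: y_def a_def field_simps)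
      next
        assume "c i (Suc j) = 3 * c i j + 2"
        then show ?thesis using i True by (simp add: y_def a_def field_simps)
      qed
    next
      case False
      then show ?thesis using c(3)[OF i, of "Suc j"] i by (simp add: y_def a_def)
    qed
    then have "y \<in> grid_cube m (Suc j) (a (Suc j))" using y0 by (simp add: grid_cube_def)
    moreover have "\<forall>i<m. a (Suc j) i \<in> {3 * a j i, 3 * a j i + 1, 3 * a j i + 2}"
      using c(2) by (simp add: a_def)
    ultimately show ?case
      unfolding menger_cubes.simps using Suc.IH by (intro CollectI bexI[of _ "a j"] conjI) auto
  qed
  with cube show ?thesis unfolding menger_set_def by (intro INT_I UN_I)
qed

section \<open>Levels, balance and the map into the Menger set\<close>

text \<open>The base value 0 is an additional last coordinate, so this is the maximum of
  \<open>m + 1\<close> numbers.\<close>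

primrec coordinate_max :: "nat \<Rightarrow> (nat \<Rightarrow> real) \<Rightarrow> real" where
  "coordinate_max 0 x = 0"
| "coordinate_max (Suc m) x = max (coordinate_max m x) (x m)"

text \<open>
  A point of \<open>m\<close>-space is read as one of \<open>m + 1\<close> coordinates, the last being 0, modulo the
  diagonal: \<open>centred\<close> picks the representative whose maximum \<open>half_range\<close> is minus its minimum.
\<close>

definition half_range :: "nat \<Rightarrow> (nat \<Rightarrow> real) \<Rightarrow> real" where
  "half_range m x = (coordinate_max m x + coordinate_max m (antipode x)) / 2"

definition centred :: "nat \<Rightarrow> (nat \<Rightarrow> real) \<Rightarrow> nat \<Rightarrow> real" where
  "centred m x i = (if i < m then x i else 0) - (coordinate_max m x - coordinate_max m (antipode x)) / 2"

text \<open>Where \<open>half_range m x\<close> is positive, this is \<open>half_range m x\<close>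
  times the sum of the levels clamped between -1 and 1. Written without division, it is continuous
  everywhere.\<close>

definition balance :: "nat \<Rightarrow> (nat \<Rightarrow> real) \<Rightarrow> real" where
  "balance m x = (\<Sum>i\<le>m. max (- half_range m x) (min (half_range m x) (real m * centred m x i)))"

text \<open>Scaled so that, for positive \<open>half_range m x\<close>, the extreme levels are
  \<open>- real m\<close> and \<open>real m\<close>; the \<open>m - 1\<close> windows of
  \<open>menger_point\<close> then fill the range from 1 to \<open>real m\<close>.\<close>

definition level :: "nat \<Rightarrow> (nat \<Rightarrow> real) \<Rightarrow> nat \<Rightarrow> real" where
  "level m x i = real m * centred m x i / half_range m x"

text \<open>
  Coordinate \<open>j\<close> reads, in distinct ternary digits, which levels have passed the window from
  \<open>j + 1\<close> to \<open>j + 2\<close>; it lies in the Cantor set unless some level is strictly inside the window.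
\<close>

definition menger_point :: "nat \<Rightarrow> nat \<Rightarrow> (nat \<Rightarrow> real) \<Rightarrow> nat \<Rightarrow> real" where
  "menger_point m L x j =
     (if Suc j < m
      then \<Sum>i<Suc m. 2 * 3 ^ i / 3 ^ (Suc m + L) * max 0 (min 1 (level m x i - (real j + 1)))
      else 0)"

lemma coordinate_max_nonneg: "0 \<le> coordinate_max m x"
  by (induction m) auto

lemma coordinate_le_max: "i < m \<Longrightarrow> x i \<le> coordinate_max m x"
  by (induction m) (auto simp: less_Suc_eq le_max_iff_disj)

lemma coordinate_max_attained: "\<exists>i\<le>m. coordinate_max m x = (if i < m then x i else 0)"
proof -
  have "coordinate_max m x = 0 \<or> (\<exists>i<m. coordinate_max m x = x i)"
    by (induction m) (auto simp: max_def less_Suc_eq)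
  then show ?thesis
  proof
    assume "coordinate_max m x = 0"
    then show ?thesis by (intro exI[of _ m]) simp
  next
    assume "\<exists>i<m. coordinate_max m x = x i"
    then obtain i where "i < m" "coordinate_max m x = x i" by blast
    then show ?thesis by (intro exI[of _ i]) simp
  qed
qed

lemma half_range_nonneg: "0 \<le> half_range m x"
  by (simp add: half_range_def coordinate_max_nonneg)

lemma half_range_pos:
  assumes "i < m" "x i \<noteq> 0"
  shows "0 < half_range m x"
proof -
  have "x i \<le> coordinate_max m x" "- x i \<le> coordinate_max m (antipode x)"
    using coordinate_le_max[OF assms(1), of x] coordinate_le_max[OF assms(1), of "antipode x"]
    by (simp_all only: antipode_apply)
  moreover have "x i < 0 \<or> 0 < x i" using assms(2) by auto
  ultimately have "0 < coordinate_max m x + coordinate_max m (antipode x)"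
    using coordinate_max_nonneg[of m x] coordinate_max_nonneg[of m "antipode x"] by linarith
  then show ?thesis by (simp add: half_range_def)
qed

lemma half_range_antipode [simp]: "half_range m (antipode x) = half_range m x"
  by (simp add: half_range_def)

lemma centred_antipode: "centred m (antipode x) i = - centred m x i"
  by (simp add: centred_def antipode_apply field_simps)

lemma level_antipode: "level m (antipode x) i = - level m x i"
  by (simp add: level_def centred_antipode)

lemma balance_antipode: "balance m (antipode x) = - balance m x"
proof -
  have "max (- r) (min r (- a)) = - max (- r) (min r a)" if "0 \<le> r" for r a :: real
    using that by (simp add: max_def min_def)
  then show ?thesis
    by (simp add: balance_def centred_antipode half_range_nonneg sum_negf)
qed

lemma level_attains_max:
  assumes "0 < half_range m x"
  shows "\<exists>i\<le>m. level m x i = real m"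
proof -
  obtain i where i: "i \<le> m" "coordinate_max m x = (if i < m then x i else 0)"
    using coordinate_max_attained by blast
  have "centred m x i = half_range m x"
    unfolding centred_def i(2)[symmetric] half_range_def by (simp add: field_simps)
  then show ?thesis using i(1) assms by (intro exI[of _ i]) (simp add: level_def)
qed

lemma sum_clamped_levels:
  assumes "0 < half_range m x" "balance m x = 0"
  shows "(\<Sum>i\<le>m. max (-1) (min 1 (level m x i))) = 0"
proof -
  let ?r = "half_range m x"
  have "max (-1) (min 1 (a / ?r)) = max (- ?r) (min ?r a) / ?r" for a
    using assms(1) by (simp add: max_def min_def field_simps)
  then have "(\<Sum>i\<le>m. max (-1) (min 1 (level m x i))) = balance m x / ?r"
    by (simp add: level_def balance_def sum_divide_distrib)
  then show ?thesis using assms(2) by simp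
qed

text \<open>A level of at least 1 contributes 1 to the sum, any other at least -1. So at most
  \<open>n + 1\<close> of the \<open>2 * n + 3\<close> levels are at least 1. One of these is
  \<open>real m\<close>, which lies in no open window, and each of the others lies in at most
  one.\<close>

lemma card_levels_inside_windows:
  fixes T :: "nat \<Rightarrow> real"
  assumes m: "m = 2 * n + 2" and s: "(\<Sum>i\<le>m. max (-1) (min 1 (T i))) = 0"
    and i0: "i0 \<le> m" "T i0 = real m"
  shows "card {j. Suc j < m \<and> (\<exists>i\<le>m. real j + 1 < T i \<and> T i < real j + 2)} \<le> n" (is "card ?J \<le> n")
proof -
  define P where "P = {i \<in> {..m}. 1 \<le> T i}"
  have P: "finite P" "P \<subseteq> {..m}" "i0 \<in> P" using i0 m by (auto simp: P_def)
  have "(\<Sum>i\<le>m. if i \<in> P then 1 else - 1 :: real) \<le> (\<Sum>i\<le>m. max (-1) (min 1 (T i)))"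
    by (rule sum_mono) (auto simp: P_def)
  also have "(\<Sum>i\<le>m. if i \<in> P then 1 else - 1 :: real) = real (card P) - real (card ({..m} - P))"
    using P by (simp add: sum.If_cases Int_absorb1 Diff_eq flip: Compl_eq)
  also have "real (card ({..m} - P)) = real (Suc m) - real (card P)"
    using P card_mono[of "{..m}" P] by (simp add: card_Diff_subset of_nat_diff)
  finally have "2 * real (card P) \<le> real (Suc m)" using s by simp
  then have "card P \<le> n + 1" using m by linarith
  then have card: "card (P - {i0}) \<le> n" using P by simp
  \<comment> \<open>Window \<open>j\<close> starts at \<open>j + 1\<close>, which is the floor of
    every level inside it.\<close>
  have "?J \<subseteq> (\<lambda>i. nat \<lfloor>T i\<rfloor> - 1) ` (P - {i0})"
  proof
    fix j assume "j \<in> ?J"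
    then obtain i where i: "Suc j < m" "i \<le> m" "real j + 1 < T i" "T i < real j + 2" by blast
    have "i \<noteq> i0"
    proof
      assume "i = i0"
      then have "real (j + 1) < real m" "real m < real (j + 2)" using i(3,4) i0(2) by simp_all
      then show False unfolding of_nat_less_iff by simp
    qed
    then have "i \<in> P - {i0}" using i by (auto simp: P_def)
    moreover have "\<lfloor>T i\<rfloor> = int j + 1" using i by (simp add: floor_eq_iff)
    ultimately show "j \<in> (\<lambda>i. nat \<lfloor>T i\<rfloor> - 1) ` (P - {i0})" by (intro image_eqI[of _ _ i]) simp_all
  qed
  then have "card ?J \<le> card (P - {i0})"
    using P(1) by (meson card_image_le card_mono finite_Diff finite_imageI le_trans)
  with card show ?thesis by simp
qed

lemma sum_ternary_digits: "(\<Sum>i<N. 2 * 3 ^ i) = (3 ^ N - 1 :: real)"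
  by (induction N) simp_all

text \<open>The factor \<open>1 / 3 ^ L\<close> squeezes all points into a small corner at the
  origin; \<open>L\<close> is chosen only in \<open>inconsistent\<close>.\<close>

lemma menger_point_bounds: "0 \<le> menger_point m L x j \<and> menger_point m L x j \<le> 1 / 3 ^ L"
proof (cases "Suc j < m")
  case True
  let ?c = "\<lambda>i. max 0 (min 1 (level m x i - (real j + 1)))"
  have "(\<Sum>i<Suc m. 2 * 3 ^ i / 3 ^ (Suc m + L) * ?c i) \<le> (\<Sum>i<Suc m. 2 * 3 ^ i / 3 ^ (Suc m + L) * 1)"
    by (intro sum_mono mult_left_mono) auto
  also have "\<dots> = (3 ^ Suc m - 1) / 3 ^ (Suc m + L)"
    by (simp only: mult_1_right sum_ternary_digits flip: sum_divide_distrib)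
  also have "\<dots> \<le> 3 ^ Suc m / 3 ^ (Suc m + L)" by (intro divide_right_mono) auto
  also have "\<dots> = 1 / 3 ^ L" by (simp add: power_add)
  finally have "(\<Sum>i<Suc m. 2 * 3 ^ i / 3 ^ (Suc m + L) * ?c i) \<le> 1 / 3 ^ L" .
  moreover have "0 \<le> (\<Sum>i<Suc m. 2 * 3 ^ i / 3 ^ (Suc m + L) * ?c i)"
    by (intro sum_nonneg mult_nonneg_nonneg) auto
  ultimately show ?thesis using True by (simp only: menger_point_def if_True simp_thms)
qed (simp add: menger_point_def)

definition windows_hit :: "nat \<Rightarrow> (nat \<Rightarrow> real) \<Rightarrow> nat set" where
  "windows_hit m x = {j. Suc j < m \<and> (\<exists>i\<le>m. real j + 1 < level m x i \<and> level m x i < real j + 2)}"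

lemma finite_windows_hit: "finite (windows_hit m x)"
  by (rule finite_subset[of _ "{..m}"]) (auto simp: windows_hit_def)

lemma menger_point_outside_windows:
  assumes "Suc j < m" "j \<notin> windows_hit m x"
  shows "menger_point m L x j =
    (\<Sum>i<Suc m. 2 * 3 ^ i / 3 ^ (Suc m + L) * of_bool (i \<in> {i. real j + 2 \<le> level m x i}))"
proof -
  have "max 0 (min 1 (level m x i - (real j + 1))) = of_bool (real j + 2 \<le> level m x i)"
    if "i < Suc m" for i
  proof -
    have "level m x i \<le> real j + 1 \<or> real j + 2 \<le> level m x i"
      using assms that by (simp only: windows_hit_def mem_Collect_eq less_Suc_eq_le) force
    then show ?thesis by (auto simp: max_def min_def)
  qed
  then show ?thesis using assms(1) by (simp only: menger_point_def if_True mem_Collect_eq cong: sum.cong)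
     (rule sum.cong, simp_all)
qed

lemma card_windows_hit:
  assumes "m = 2 * n + 2" "0 < half_range m x" "balance m x = 0"
  shows "card (windows_hit m x) \<le> n"
  unfolding windows_hit_def
  using level_attains_max[OF assms(2)] card_levels_inside_windows[OF assms(1) sum_clamped_levels[OF assms(2,3)]]
  by blast

lemma menger_point_in_menger_set:
  assumes "m = 2 * n + 2" "0 < half_range m x" "balance m x = 0"
  shows "menger_point m L x \<in> menger_set n (2 * n + 1)"
proof (rule menger_setI)
  let ?y = "menger_point m L x"
  have "1 / 3 ^ L \<le> (1::real)" by simp
  then show "0 \<le> ?y i \<and> ?y i \<le> 1" for i
    using menger_point_bounds[of m L x i] by linarith
  show "?y i = 0" if "2 * n + 1 \<le> i" for i using that assms(1) by (simp add: menger_point_def)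
  have "in_cantor_set (?y j)" if "j < 2 * n + 1" "j \<notin> windows_hit m x" for j
  proof -
    have "Suc j < m" using that(1) assms(1) by simp
    from menger_point_outside_windows[OF this that(2)] show ?thesis
      by (simp only: in_cantor_set_digits)
  qed
  then have "{i. i < 2 * n + 1 \<and> \<not> in_cantor_set (?y i)} \<subseteq> windows_hit m x" by blast
  then have "card {i. i < 2 * n + 1 \<and> \<not> in_cantor_set (?y i)} \<le> card (windows_hit m x)"
    by (intro card_mono finite_windows_hit)
  then show "card {i. i < 2 * n + 1 \<and> \<not> in_cantor_set (?y i)} \<le> n"
    using card_windows_hit[OF assms] by simp
qed

text \<open>The lower digits add up to less than \<open>3 ^ N\<close>, so they cannot make up for a
  difference of \<open>2 * 3 ^ N\<close> in the top digit.\<close>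

lemma ternary_digits_unique:
  assumes "(\<Sum>i<N. 2 * 3 ^ i * of_bool (i \<in> A)) = (\<Sum>i<N. 2 * 3 ^ i * of_bool (i \<in> B) :: real)" "i < N"
  shows "i \<in> A \<longleftrightarrow> i \<in> B"
  using assms
proof (induction N)
  case (Suc N)
  let ?s = "\<lambda>A. \<Sum>i<N. 2 * 3 ^ i * of_bool (i \<in> A) :: real"
  have bd: "0 \<le> ?s A \<and> ?s A < 3 ^ N" for A
  proof
    show "0 \<le> ?s A" by (intro sum_nonneg) simp
    have "?s A \<le> (\<Sum>i<N. 2 * 3 ^ i)" by (rule sum_mono) simp
    then show "?s A < 3 ^ N" by (simp add: sum_ternary_digits)
  qed
  have eq: "?s A + 2 * 3 ^ N * of_bool (N \<in> A) = ?s B + 2 * 3 ^ N * of_bool (N \<in> B)"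
    using Suc.prems(1) by simp
  have p: "0 < (3::real) ^ N" by simp
  have top: "N \<in> A \<longleftrightarrow> N \<in> B"
  proof (rule ccontr)
    assume "\<not> ?thesis"
    then have "?s A + 2 * 3 ^ N = ?s B \<or> ?s B + 2 * 3 ^ N = ?s A"
      using eq by (cases "N \<in> A") auto
    then show False using bd[of A] bd[of B] p by linarith
  qed
  with eq have "?s A = ?s B" by simp
  then show ?case using Suc.IH Suc.prems(2) top by (cases "i = N") simp_all
qed simp

text \<open>The levels of \<open>x\<close> and those of its antipode hit at most \<open>n\<close>
  windows each, so one of the \<open>2 * n + 1\<close> windows is missed by both. There the digits
  show which levels are above the window, and the index whose level is \<open>real m\<close> for
  \<open>x\<close> has level \<open>- real m\<close> for the antipode.\<close>

lemma menger_point_antipode_neq: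
  assumes m: "m = 2 * n + 2" and r: "0 < half_range m x" and b: "balance m x = 0"
  shows "menger_point m L x \<noteq> menger_point m L (antipode x)"
proof
  assume eq: "menger_point m L x = menger_point m L (antipode x)"
  let ?H = "windows_hit m x \<union> windows_hit m (antipode x)"
  have "card ?H \<le> card (windows_hit m x) + card (windows_hit m (antipode x))" by (rule card_Un_le)
  also have "\<dots> \<le> n + n"
    using card_windows_hit[OF m r b] card_windows_hit[OF m, of "antipode x"] r b
    by (simp add: balance_antipode)
  finally have "card ?H < card {..<2 * n + 1}" by simp
  then have "\<not> {..<2 * n + 1} \<subseteq> ?H"
    using card_mono[OF finite_UnI[OF finite_windows_hit finite_windows_hit]] leD by blast
  then obtain j where j: "Suc j < m" "j \<notin> windows_hit m x" "j \<notin> windows_hit m (antipode x)"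
    using m by auto
  let ?A = "\<lambda>y. {i. real j + 2 \<le> level m y i}"
  have y: "menger_point m L y j = (\<Sum>i<Suc m. 2 * 3 ^ i * of_bool (i \<in> ?A y)) / 3 ^ (Suc m + L)"
    if "j \<notin> windows_hit m y" for y
  proof -
    have "menger_point m L y j = (\<Sum>i<Suc m. 2 * 3 ^ i / 3 ^ (Suc m + L) * of_bool (i \<in> ?A y))"
      by (rule menger_point_outside_windows[OF j(1) that])
    also have "\<dots> = (\<Sum>i<Suc m. 2 * 3 ^ i * of_bool (i \<in> ?A y)) / 3 ^ (Suc m + L)"
      unfolding sum_divide_distrib by (rule sum.cong) (simp_all only: times_divide_eq_left)
    finally show ?thesis .
  qed
  have nz: "(3::real) ^ (Suc m + L) \<noteq> 0" by simp
  have digits: "(\<Sum>i<Suc m. 2 * 3 ^ i * of_bool (i \<in> ?A x)) =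
      (\<Sum>i<Suc m. 2 * 3 ^ i * of_bool (i \<in> ?A (antipode x)) :: real)"
    using fun_cong[OF eq, of j] nz unfolding y[OF j(2)] y[OF j(3)] divide_cancel_right
    by blast
  obtain i where i: "i \<le> m" "level m x i = real m" using level_attains_max[OF r] by blast
  then have "i \<in> ?A x" using j(1) by simp
  then have "i \<in> ?A (antipode x)" using ternary_digits_unique[OF digits, of i] i(1) by simp
  then show False using i(2) by (simp add: level_antipode)
qed

section \<open>Continuity of the balance and of the Menger points\<close>

lemma continuous_on_antipode: "continuous_on S antipode"
  unfolding antipode_def
  by (intro continuous_on_coordinatewise_then_product continuous_on_minus
        continuous_on_subset[OF continuous_on_product_coordinates]) simp

lemma continuous_on_coordinate: "continuous_on S (\<lambda>x::nat \<Rightarrow> real. x i)"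
  by (rule continuous_on_subset[OF continuous_on_product_coordinates]) simp

lemma continuous_on_coordinate_max: "continuous_on S (coordinate_max m)"
  by (induction m) (simp_all add: continuous_on_max continuous_on_coordinate)

lemma continuous_on_coordinate_max_antipode: "continuous_on S (\<lambda>x. coordinate_max m (antipode x))"
  by (rule continuous_on_compose2[OF continuous_on_coordinate_max[of UNIV] continuous_on_antipode]) simp

lemma continuous_on_half_range: "continuous_on S (half_range m)"
  unfolding half_range_def [abs_def]
  by (intro continuous_intros continuous_on_coordinate_max continuous_on_coordinate_max_antipode) simp

lemma continuous_on_centred: "continuous_on S (\<lambda>x. centred m x i)"
  unfolding centred_def
  by (cases "i < m") (auto intro!: continuous_intros continuous_on_coordinate
      continuous_on_coordinate_max continuous_on_coordinate_max_antipode)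

lemma continuous_on_balance: "continuous_on S (balance m)"
  unfolding balance_def [abs_def]
  by (intro continuous_on_sum continuous_on_max continuous_on_min continuous_on_minus
        continuous_on_mult continuous_on_const continuous_on_half_range continuous_on_centred)

lemma continuous_on_menger_point:
  assumes "\<And>x. x \<in> S \<Longrightarrow> 0 < half_range m x"
  shows "continuous_on S (\<lambda>x. menger_point m L x j)"
proof -
  have "continuous_on S (\<lambda>x. level m x i)" for i
    unfolding level_def
    by (intro continuous_on_divide continuous_on_mult continuous_on_const continuous_on_half_range
          continuous_on_centred) (use assms in force)
  then show ?thesis
    unfolding menger_point_def
    by (cases "Suc j < m")
       (simp_all only: if_True if_False, intro continuous_on_sum continuous_on_max continuous_on_min
          continuous_on_mult continuous_on_diff continuous_on_const, simp_all)
qed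

section \<open>The cube, its reflection and its boundary\<close>

definition cube_points :: "nat \<Rightarrow> (nat \<Rightarrow> real) set" where
  "cube_points k = {v. \<forall>i. 0 \<le> v i \<and> v i \<le> (if i < k then 1 else 0)}"

definition cube_reflection :: "nat \<Rightarrow> (nat \<Rightarrow> real) \<Rightarrow> nat \<Rightarrow> real" where
  "cube_reflection k v = (\<lambda>i. if i < k then 1 - v i else 0)"

definition cube_boundary :: "nat \<Rightarrow> (nat \<Rightarrow> real) set" where
  "cube_boundary k = cube_points k \<inter> (\<Union>i<k. {v. v i = 0} \<union> {v. v i = 1})"

lemma cube_reflection_in_cube:
  assumes "v \<in> cube_points k"
  shows "cube_reflection k v \<in> cube_points k"
  unfolding cube_points_def
proof (intro CollectI allI)
  fix i
  have "0 \<le> v i \<and> v i \<le> (if i < k then 1 else 0)" using assms by (simp add: cube_points_def)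
  then show "0 \<le> cube_reflection k v i \<and> cube_reflection k v i \<le> (if i < k then 1 else 0)"
    by (cases "i < k") (simp_all add: cube_reflection_def)
qed

lemma compact_cube_points: "compact (cube_points k)"
  unfolding cube_points_def by (rule compact_box_fun)

lemma compact_cube_boundary: "compact (cube_boundary k)"
  unfolding cube_boundary_def
  by (intro compact_Int_closed compact_cube_points closed_UN closed_Un closed_Collect_eq
        continuous_on_const continuous_on_coordinate finite_lessThan ballI)

lemma continuous_on_cube_reflection: "continuous_on S (cube_reflection k)"
  unfolding cube_reflection_def
proof (rule continuous_on_coordinatewise_then_product)
  fix i
  show "continuous_on S (\<lambda>v. if i < k then 1 - v i else 0)"
    by (cases "i < k") (simp_all add: continuous_on_diff continuous_on_coordinate)
qed

lemma origin_in_menger_set: "(\<lambda>i. 0) \<in> menger_set n m"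
  by (rule menger_setI) (simp_all add: in_cantor_set_0)

section \<open>Distance estimates for an injective map\<close>

text \<open>The embedding reduced to its first \<open>2 * n + k\<close> coordinate functions; these
  assumptions are refuted in \<open>inconsistent\<close>.\<close>

locale injective_menger_map =
  fixes n k :: nat and f :: "(nat \<Rightarrow> real) \<times> (nat \<Rightarrow> real) \<Rightarrow> nat \<Rightarrow> real"
  assumes continuous_f:
      "\<And>i. i < 2 * n + k \<Longrightarrow> continuous_on (menger_set n (2 * n + 1) \<times> cube_points k) (\<lambda>p. f p i)"
    and inj_f: "\<And>p q. p \<in> menger_set n (2 * n + 1) \<times> cube_points k \<Longrightarrow>
      q \<in> menger_set n (2 * n + 1) \<times> cube_points k \<Longrightarrow> (\<And>i. i < 2 * n + k \<Longrightarrow> f p i = f q i) \<Longrightarrow> p = q"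
begin

abbreviation K :: "(nat \<Rightarrow> real) set" where "K \<equiv> menger_set n (2 * n + 1)"
abbreviation V :: "(nat \<Rightarrow> real) set" where "V \<equiv> cube_points k"
abbreviation origin :: "nat \<Rightarrow> real" where "origin \<equiv> \<lambda>i. 0"

definition image_dist :: "(nat \<Rightarrow> real) \<times> (nat \<Rightarrow> real) \<Rightarrow> (nat \<Rightarrow> real) \<times> (nat \<Rightarrow> real) \<Rightarrow> real" where
  "image_dist p q = (\<Sum>i<2 * n + k. \<bar>f p i - f q i\<bar>)"

lemma continuous_on_f_Pair:
  assumes "i < 2 * n + k" "continuous_on S a" "continuous_on S b" "a ` S \<subseteq> K" "b ` S \<subseteq> V"
  shows "continuous_on S (\<lambda>x. f (a x, b x) i)"
  by (rule continuous_on_compose2[OF continuous_f[OF assms(1)] continuous_on_Pair[OF assms(2,3)]])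
     (use assms(4,5) in blast)

text \<open>A boundary point differs from its reflection in a coordinate that is 0 or 1, so by
  injectivity the distance is positive, and on the compact boundary it attains its minimum. For
  \<open>k = 0\<close> the boundary is empty.\<close>

lemma image_dist_reflection_bound: "\<exists>c>0. \<forall>v\<in>cube_boundary k. c \<le> image_dist (origin, v) (origin, cube_reflection k v)"
proof (cases "cube_boundary k = {}")
  case False
  let ?g = "\<lambda>v. image_dist (origin, v) (origin, cube_reflection k v)"
  have V: "cube_boundary k \<subseteq> V" by (auto simp: cube_boundary_def)
  have "continuous_on (cube_boundary k) ?g"
    unfolding image_dist_def
    by (intro continuous_on_sum continuous_on_rabs continuous_on_diff continuous_on_f_Pair
          continuous_on_const continuous_on_id continuous_on_cube_reflection)
       (use V cube_reflection_in_cube origin_in_menger_set in auto)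
  from continuous_attains_inf[OF compact_cube_boundary False this]
  obtain v where v: "v \<in> cube_boundary k" "\<forall>w\<in>cube_boundary k. ?g v \<le> ?g w" by blast
  have "(origin, v) \<noteq> (origin, cube_reflection k v)"
  proof
    assume "(origin, v) = (origin, cube_reflection k v)"
    then have eq: "v i = cube_reflection k v i" for i by simp
    from v(1) obtain i where i: "i < k" "v i = 0 \<or> v i = 1" by (auto simp: cube_boundary_def)
    have "v i = 1 - v i" using eq[of i] unfolding cube_reflection_def if_P[OF i(1)] .
    then show False using i(2) by linarith
  qed
  then obtain i where i: "i < 2 * n + k" "f (origin, v) i \<noteq> f (origin, cube_reflection k v) i"
    using inj_f[of "(origin, v)" "(origin, cube_reflection k v)"] v(1) V
      cube_reflection_in_cube origin_in_menger_set by blast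
  have "0 < \<bar>f (origin, v) i - f (origin, cube_reflection k v) i\<bar>" using i(2) by simp
  also have "\<dots> \<le> ?g v" unfolding image_dist_def by (rule member_le_sum) (use i(1) in auto)
  finally show ?thesis using v(2) by blast
qed (auto intro: exI[of _ 1])

text \<open>Continuity at the origin, uniform over the compact cube: counterexamples for all
  \<open>L\<close> would have a subsequence whose cube parts converge and whose Menger parts tend to
  the origin.\<close>

lemma image_dist_near_origin:
  assumes "0 < c"
  shows "\<exists>L. \<forall>x\<in>K. \<forall>v\<in>V. (\<forall>i. 0 \<le> x i \<and> x i \<le> 1 / 3 ^ L) \<longrightarrow> image_dist (x, v) (origin, v) < c"
proof (rule ccontr)
  assume "\<not> ?thesis"
  then have "\<forall>L. \<exists>p. fst p \<in> K \<and> snd p \<in> V \<and> (\<forall>i. 0 \<le> fst p i \<and> fst p i \<le> 1 / 3 ^ L) \<and>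
      c \<le> image_dist p (origin, snd p)"
    by (force simp: not_less)
  from choice[OF this] obtain p where p: "fst (p L) \<in> K" "snd (p L) \<in> V"
    "0 \<le> fst (p L) i" "fst (p L) i \<le> 1 / 3 ^ L" "c \<le> image_dist (p L) (origin, snd (p L))" for L i
    by blast
  have "\<forall>L. snd (p L) \<in> V" using p(2) by blast
  from seq_compactE[OF compact_imp_seq_compact[OF compact_cube_points] this] obtain l r where
    l: "l \<in> V" "strict_mono r" "((\<lambda>L. snd (p L)) \<circ> r) \<longlonglongrightarrow> l" .
  have three: "(\<lambda>L. 1 / 3 ^ L :: real) \<longlonglongrightarrow> 0"
    using LIMSEQ_realpow_zero[of "1 / 3"] by (simp add: power_divide)
  have "(\<lambda>L. fst (p L)) \<longlonglongrightarrow> origin"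
    unfolding tendsto_fun_iff
    by (intro allI tendsto_sandwich[OF _ _ tendsto_const three] always_eventually) (rule p(3,4))+
  from LIMSEQ_subseq_LIMSEQ[OF this l(2)]
  have fst_lim: "(\<lambda>L. fst (p (r L))) \<longlonglongrightarrow> origin" by (simp only: o_def)
  have snd_lim: "(\<lambda>L. snd (p (r L))) \<longlonglongrightarrow> l" using l(3) by (simp only: o_def)
  have lim: "(\<lambda>L. f (a L, snd (p (r L))) i) \<longlonglongrightarrow> f (origin, l) i"
    if "a \<longlonglongrightarrow> origin" "\<And>L. a L \<in> K" "i < 2 * n + k" for a i
    by (rule continuous_on_tendsto_compose[OF continuous_f[OF that(3)] tendsto_Pair[OF that(1) snd_lim]])
       (use origin_in_menger_set l(1) that(2) p(2) in \<open>auto intro!: always_eventually\<close>)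
  have "(\<lambda>L. image_dist (fst (p (r L)), snd (p (r L))) (origin, snd (p (r L)))) \<longlonglongrightarrow>
      (\<Sum>i<2 * n + k. \<bar>f (origin, l) i - f (origin, l) i\<bar>)"
    unfolding image_dist_def
    by (intro tendsto_sum tendsto_rabs tendsto_diff lim fst_lim tendsto_const p(1) origin_in_menger_set)
       auto
  then have "(\<lambda>L. image_dist (p (r L)) (origin, snd (p (r L)))) \<longlonglongrightarrow> 0" by simp
  then have "c \<le> 0" by (rule LIMSEQ_le_const) (use p(5) in blast)
  with assms show False by simp
qed

section \<open>The odd difference map on the sphere\<close>

definition menger_mass :: "(nat \<Rightarrow> real) \<Rightarrow> real" where
  "menger_mass p = (\<Sum>i<2 * n + 2. \<bar>p i\<bar>)"

text \<open>It rises from 0 at mass 1/6, above which \<open>menger_point\<close> is well-behaved, to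
  1 at mass 1/3; so all fading occurs at mass below 1/2, where \<open>cube_part\<close> is on the
  boundary.\<close>

definition cutoff :: "(nat \<Rightarrow> real) \<Rightarrow> real" where
  "cutoff p = max 0 (min 1 (6 * menger_mass p - 1))"

definition cube_part :: "(nat \<Rightarrow> real) \<Rightarrow> nat \<Rightarrow> real" where
  "cube_part p = (\<lambda>i. if i < k then (1 + max (-1) (min 1 (2 * real k * p (2 * n + 2 + i)))) / 2 else 0)"

text \<open>
  The difference of the \<open>f\<close>-images of two disjointly supported points, except that near the locus
  where all Menger coordinates vanish, on which \<open>menger_point\<close> is undefined, both Menger points
  are faded to the origin.
\<close>

definition difference_map :: "nat \<Rightarrow> nat \<Rightarrow> (nat \<Rightarrow> real) \<Rightarrow> real" where
  "difference_map L i p =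
     (let v = cube_part p; w = cube_part (antipode p);
          x = menger_point (2 * n + 2) L p; y = menger_point (2 * n + 2) L (antipode p)
      in cutoff p * ((f (x, v) i - f (origin, v) i) - (f (y, w) i - f (origin, w) i)) +
         (f (origin, v) i - f (origin, w) i))"

lemma menger_mass_antipode: "menger_mass (antipode p) = menger_mass p"
  by (simp add: menger_mass_def antipode_apply)

lemma difference_map_antipode: "difference_map L i (antipode p) = - difference_map L i p"
  by (simp add: difference_map_def Let_def cutoff_def menger_mass_antipode algebra_simps)

lemma cube_part_in_cube: "cube_part p \<in> V"
  by (auto simp: cube_part_def cube_points_def max_def min_def)

lemma cube_part_antipode: "cube_part (antipode p) = cube_reflection k (cube_part p)"
proof -
  have "(1 + max (-1) (min 1 (- a))) / 2 = 1 - (1 + max (-1) (min 1 a)) / 2" for a :: real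
    by (simp add: max_def min_def field_simps)
  then show ?thesis
    by (simp add: cube_part_def cube_reflection_def antipode_apply fun_eq_iff)
qed

text \<open>More than half of the sum norm sits on the last \<open>k\<close> coordinates, so one of
  them has absolute value at least \<open>1 / (2 * real k)\<close>, where the clamp in
  \<open>cube_part\<close> saturates.\<close>

lemma cube_part_in_boundary:
  assumes "p \<in> octahedral_sphere (2 * n + k + 1)" "menger_mass p < 1 / 2"
  shows "cube_part p \<in> cube_boundary k"
proof -
  have "{..2 * n + k + 1} = {..<2 * n + 2} \<union> (\<lambda>i. 2 * n + 2 + i) ` {..<k}"
  proof (intro set_eqI iffI)
    fix i assume "i \<in> {..2 * n + k + 1}"
    then show "i \<in> {..<2 * n + 2} \<union> (\<lambda>i. 2 * n + 2 + i) ` {..<k}"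
      by (cases "i < 2 * n + 2") (auto intro: image_eqI[of _ _ "i - (2 * n + 2)"])
  qed auto
  then have "(\<Sum>i\<le>2 * n + k + 1. \<bar>p i\<bar>) = menger_mass p + (\<Sum>i\<in>(\<lambda>i. 2 * n + 2 + i) ` {..<k}. \<bar>p i\<bar>)"
    unfolding menger_mass_def by (simp only:) (rule sum.union_disjoint, auto)
  also have "(\<Sum>i\<in>(\<lambda>i. 2 * n + 2 + i) ` {..<k}. \<bar>p i\<bar>) = (\<Sum>i<k. \<bar>p (2 * n + 2 + i)\<bar>)"
    by (rule sum.reindex_cong[of "\<lambda>i. 2 * n + 2 + i"]) (auto simp: inj_on_def)
  finally have big: "1 / 2 < (\<Sum>i<k. \<bar>p (2 * n + 2 + i)\<bar>)"
    using assms by (simp add: octahedral_sphere_def)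
  have "\<exists>i<k. 1 \<le> 2 * real k * \<bar>p (2 * n + 2 + i)\<bar>"
  proof (rule ccontr)
    assume "\<not> ?thesis"
    then have "\<bar>p (2 * n + 2 + i)\<bar> \<le> 1 / (2 * real k)" if "i < k" for i
      using that by (force simp: not_le field_simps)
    then have "(\<Sum>i<k. \<bar>p (2 * n + 2 + i)\<bar>) \<le> (\<Sum>i<k. 1 / (2 * real k))"
      by (intro sum_mono) simp
    also have "\<dots> \<le> 1 / 2" by (cases "k = 0") simp_all
    finally show False using big by simp
  qed
  then obtain i where i: "i < k" "1 \<le> 2 * real k * \<bar>p (2 * n + 2 + i)\<bar>" by blast
  have "\<bar>2 * real k * p (2 * n + 2 + i)\<bar> = 2 * real k * \<bar>p (2 * n + 2 + i)\<bar>"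
    by (simp add: abs_mult)
  then have "2 * real k * p (2 * n + 2 + i) \<le> -1 \<or> 1 \<le> 2 * real k * p (2 * n + 2 + i)"
    using i(2) by linarith
  then have "cube_part p i = 0 \<or> cube_part p i = 1"
    using i(1) by (auto simp: cube_part_def max_def min_def)
  then show ?thesis using i(1) cube_part_in_cube[of p] by (auto simp: cube_boundary_def)
qed

lemma continuous_on_cube_part: "continuous_on S cube_part"
  unfolding cube_part_def
proof (rule continuous_on_coordinatewise_then_product)
  fix i
  have "continuous_on S (\<lambda>p. (1 + max (-1) (min 1 (2 * real k * p (2 * n + 2 + i)))) / 2)"
    by (intro continuous_on_divide continuous_on_add continuous_on_max continuous_on_min
          continuous_on_mult continuous_on_const continuous_on_coordinate) simp
  then show "continuous_on S
     (\<lambda>p. if i < k then (1 + max (-1) (min 1 (2 * real k * p (2 * n + 2 + i)))) / 2 else 0)"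
    by (cases "i < k") simp_all
qed

lemma continuous_on_menger_mass: "continuous_on S menger_mass"
  unfolding menger_mass_def [abs_def]
  by (intro continuous_on_sum continuous_on_rabs continuous_on_coordinate)

lemma half_range_pos_menger_mass:
  assumes "0 < menger_mass p"
  shows "0 < half_range (2 * n + 2) p"
proof -
  have "\<exists>i<2 * n + 2. p i \<noteq> 0"
  proof (rule ccontr)
    assume "\<not> ?thesis"
    then have "menger_mass p = 0" by (simp add: menger_mass_def)
    with assms show False by simp
  qed
  then show ?thesis using half_range_pos by blast
qed

text \<open>Two closed pieces are glued. Up to mass 1/6 the cutoff vanishes and removes the Menger
  points; from mass 1/6 on \<open>half_range\<close> is positive, so they are continuous and, by
  balance, in \<open>K\<close>.\<close>

lemma continuous_on_difference_map:
  assumes i: "i < 2 * n + k"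
  shows "continuous_on {p \<in> octahedral_sphere d. balance (2 * n + 2) p = 0} (difference_map L i)"
    (is "continuous_on ?D _")
proof -
  let ?m = "2 * n + 2"
  let ?A = "?D \<inter> {p. menger_mass p \<le> 1 / 6}" and ?B = "?D \<inter> {p. 1 / 6 \<le> menger_mass p}"
  have "?D = octahedral_sphere d \<inter> {p. balance ?m p = 0}" by blast
  moreover have "closed {p. balance ?m p = 0}"
    by (intro closed_Collect_eq continuous_on_balance continuous_on_const)
  ultimately have D: "closed ?D"
    by (simp add: closed_Int compact_imp_closed compact_octahedral_sphere)
  have closed: "closed ?A" "closed ?B"
    by (intro closed_Int D closed_Collect_le continuous_on_menger_mass continuous_on_const)+
  have cp: "continuous_on S (\<lambda>p. cube_part (antipode p))" for S
    by (rule continuous_on_compose2[OF continuous_on_cube_part[of UNIV] continuous_on_antipode]) simp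
  have base: "continuous_on S (\<lambda>p. f (origin, cube_part p) i)"
    "continuous_on S (\<lambda>p. f (origin, cube_part (antipode p)) i)" for S
    by (intro continuous_on_f_Pair i continuous_on_const continuous_on_cube_part cp;
        use origin_in_menger_set cube_part_in_cube in blast)+
  have "continuous_on ?A (difference_map L i)"
  proof (rule continuous_on_eq)
    show "continuous_on ?A (\<lambda>p. f (origin, cube_part p) i - f (origin, cube_part (antipode p)) i)"
      by (intro continuous_on_diff base)
    show "f (origin, cube_part p) i - f (origin, cube_part (antipode p)) i = difference_map L i p"
      if "p \<in> ?A" for p
    proof -
      have "cutoff p = 0" using that by (simp add: cutoff_def)
      then show ?thesis by (simp add: difference_map_def Let_def)
    qed
  qed
  moreover have "continuous_on ?B (difference_map L i)"
  proof -
    have pos: "0 < half_range ?m p" if "p \<in> ?B" for p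
      by (rule half_range_pos_menger_mass) (use that in simp)
    have x: "continuous_on ?B (menger_point ?m L)"
      by (rule continuous_on_coordinatewise_then_product) (rule continuous_on_menger_point[OF pos])
    have B': "antipode ` ?B \<subseteq> ?B"
      by (auto simp: balance_antipode menger_mass_antipode)
    have y: "continuous_on ?B (\<lambda>p. menger_point ?m L (antipode p))"
      by (rule continuous_on_compose2[OF x continuous_on_antipode B'])
    have K: "menger_point ?m L ` ?B \<subseteq> K"
    proof
      fix z assume "z \<in> menger_point ?m L ` ?B"
      then obtain p where "z = menger_point ?m L p" "p \<in> ?B" by blast
      then show "z \<in> K" using menger_point_in_menger_set[OF refl pos] by blast
    qed
    then have K': "(\<lambda>p. menger_point ?m L (antipode p)) ` ?B \<subseteq> K" using B' by blast
    have V: "cube_part ` ?B \<subseteq> V" "(\<lambda>p. cube_part (antipode p)) ` ?B \<subseteq> V"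
      using cube_part_in_cube by blast+
    have "continuous_on ?B cutoff"
      unfolding cutoff_def [abs_def]
      by (intro continuous_on_max continuous_on_min continuous_on_diff continuous_on_mult
            continuous_on_const continuous_on_menger_mass)
    then show ?thesis
      unfolding difference_map_def Let_def
      by (intro continuous_on_add continuous_on_mult continuous_on_diff base
            continuous_on_f_Pair[OF i x continuous_on_cube_part K V(1)]
            continuous_on_f_Pair[OF i y cp K' V(2)])
  qed
  ultimately have "continuous_on (?A \<union> ?B) (difference_map L i)"
    using closed by (intro continuous_on_closed_Un)
  moreover have "?A \<union> ?B = ?D" by auto
  ultimately show ?thesis by simp
qed

text \<open>The difference map is controlled only where the balance vanishes. It is extended to the
  sphere by Tietze and made odd; the balance itself is the last of the \<open>2 * n + k + 1\<close>
  functions for Borsuk-Ulam.\<close>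

lemma difference_map_common_zero:
  obtains p where "p \<in> octahedral_sphere (2 * n + k + 1)" "balance (2 * n + 2) p = 0"
    "\<And>i. i < 2 * n + k \<Longrightarrow> difference_map L i p = 0"
proof -
  let ?d = "2 * n + k + 1" and ?m = "2 * n + 2"
  let ?S = "octahedral_sphere ?d"
  let ?D = "{p \<in> ?S. balance ?m p = 0}"
  have "\<exists>g. continuous_on ?S g \<and> (\<forall>p\<in>?D. g p = difference_map L i p)" if i: "i < 2 * n + k" for i
  proof -
    have "closed {p. balance ?m p = 0}"
      by (intro closed_Collect_eq continuous_on_balance continuous_on_const)
    then have "closedin (top_of_set ?S) ({p. balance ?m p = 0} \<inter> ?S)"
      by (metis closedin_closed_Int inf_commute)
    moreover have "{p. balance ?m p = 0} \<inter> ?S = ?D" by blast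
    ultimately have "closedin (top_of_set ?S) ?D" by simp
    with continuous_on_difference_map[OF i] obtain g where
      "continuous_on ?S g" "\<And>p. p \<in> ?D \<Longrightarrow> g p = difference_map L i p"
      by (rule Tietze_unbounded) (rule that)
    then show ?thesis by (intro exI[of _ g] conjI ballI)
  qed
  then have "\<forall>i. \<exists>g. i < 2 * n + k \<longrightarrow> continuous_on ?S g \<and> (\<forall>p\<in>?D. g p = difference_map L i p)"
    by blast
  from choice[OF this] obtain g where g: "\<forall>i. i < 2 * n + k \<longrightarrow>
      continuous_on ?S (g i) \<and> (\<forall>p\<in>?D. g i p = difference_map L i p)" by blast
  \<comment> \<open>Taking the odd part changes nothing on \<open>?D\<close>, where the difference
    map is odd already.\<close>
  define F where "F i p = (if i < 2 * n + k then (g i p - g i (antipode p)) / 2 else balance ?m p)"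
    for i p
  have "continuous_on ?S (F i)" for i
  proof (cases "i < 2 * n + k")
    case True
    then have gi: "continuous_on ?S (g i)" using g by blast
    have "continuous_on ?S (\<lambda>p. g i (antipode p))"
      by (rule continuous_on_compose2[OF gi continuous_on_antipode]) auto
    with gi have "continuous_on ?S (\<lambda>p. (g i p - g i (antipode p)) / 2)"
      by (intro continuous_on_divide continuous_on_diff continuous_on_const) simp_all
    then show ?thesis using True by (simp add: F_def [abs_def])
  next
    case False
    then show ?thesis using continuous_on_balance[of ?S ?m] by (simp add: F_def [abs_def])
  qed
  moreover have "F i (antipode p) = - F i p" for i p
    by (simp add: F_def balance_antipode field_simps)
  ultimately obtain p where p: "p \<in> ?S" "\<forall>i<?d. F i p = 0"
    using Borsuk_Ulam_octahedral[of ?d F] by blast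
  have b: "balance ?m p = 0" using p(2)[rule_format, of "2 * n + k"] by (simp add: F_def)
  have "difference_map L i p = 0" if i: "i < 2 * n + k" for i
  proof -
    have "g i p = difference_map L i p" "g i (antipode p) = difference_map L i (antipode p)"
      using g i p(1) b by (simp_all add: balance_antipode)
    moreover have "F i p = 0" using p(2) i by simp
    ultimately show ?thesis using i by (simp add: F_def difference_map_antipode)
  qed
  with p(1) b show thesis by (rule that)
qed

text \<open>At a common zero of mass at least 1/3 nothing is faded, and \<open>f\<close> identifies
  two distinct points. At smaller mass, reflected boundary points have images at distance at least
  \<open>c\<close>, which two displacements below \<open>c / 2\<close> cannot bridge.\<close>

lemma inconsistent: False
proof -
  let ?m = "2 * n + 2"
  obtain c where c: "0 < c"
    "\<forall>v\<in>cube_boundary k. c \<le> image_dist (origin, v) (origin, cube_reflection k v)"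
    using image_dist_reflection_bound by blast
  obtain L where L: "\<forall>x\<in>K. \<forall>v\<in>V. (\<forall>i. 0 \<le> x i \<and> x i \<le> 1 / 3 ^ L) \<longrightarrow>
      image_dist (x, v) (origin, v) < c / 2"
    using image_dist_near_origin[of "c / 2"] c(1) by auto
  obtain p where p: "p \<in> octahedral_sphere (2 * n + k + 1)" "balance ?m p = 0"
    "\<And>i. i < 2 * n + k \<Longrightarrow> difference_map L i p = 0"
    by (rule difference_map_common_zero[of L]) (rule that)
  define v where "v = cube_part p"
  define w where "w = cube_part (antipode p)"
  define x where "x = menger_point ?m L p"
  define y where "y = menger_point ?m L (antipode p)"
  define t where "t = cutoff p"
  have V: "v \<in> V" "w \<in> V" by (simp_all add: v_def w_def cube_part_in_cube)
  have zero: "t * ((f (x, v) i - f (origin, v) i) - (f (y, w) i - f (origin, w) i)) +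
      (f (origin, v) i - f (origin, w) i) = 0" if "i < 2 * n + k" for i
    using p(3)[OF that] by (simp add: difference_map_def Let_def x_def y_def v_def w_def t_def)
  have xy: "x \<in> K" "y \<in> K" "x \<noteq> y" if "0 < menger_mass p"
  proof -
    have r: "0 < half_range ?m p" by (rule half_range_pos_menger_mass[OF that])
    show "x \<in> K" unfolding x_def by (rule menger_point_in_menger_set[OF refl r p(2)])
    show "y \<in> K"
      unfolding y_def by (rule menger_point_in_menger_set[OF refl])
         (simp_all only: half_range_antipode r balance_antipode p(2) minus_zero)
    show "x \<noteq> y"
      unfolding x_def y_def by (rule menger_point_antipode_neq[OF refl r p(2)])
  qed
  show False
  proof (cases "1 / 3 \<le> menger_mass p")
    case True
    then have "t = 1" by (simp add: t_def cutoff_def)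
    then have "f (x, v) i = f (y, w) i" if "i < 2 * n + k" for i using zero[OF that] by simp
    moreover have "x \<in> K" "y \<in> K" "x \<noteq> y" using xy True by auto
    ultimately show False using inj_f[of "(x, v)" "(y, w)"] V by auto
  next
    case False
    then have "v \<in> cube_boundary k" unfolding v_def by (intro cube_part_in_boundary p(1)) simp
    then have "c \<le> image_dist (origin, v) (origin, w)"
      using c(2) by (simp add: v_def w_def cube_part_antipode)
    \<comment> \<open>The equation \<open>zero\<close> expresses the left difference as
      \<open>t\<close> times a difference of two displacements; the triangle inequality is then
      summed over the coordinates.\<close>
    also have "\<dots> \<le> t * (image_dist (x, v) (origin, v) + image_dist (y, w) (origin, w))"
      unfolding image_dist_def sum.distrib[symmetric] sum_distrib_left
    proof (rule sum_mono)
      fix i assume "i \<in> {..<2 * n + k}"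
      then have "f (origin, v) i - f (origin, w) i =
          t * ((f (y, w) i - f (origin, w) i) - (f (x, v) i - f (origin, v) i))"
        using zero[of i] by (simp add: algebra_simps)
      then have "\<bar>f (origin, v) i - f (origin, w) i\<bar> =
          \<bar>t\<bar> * \<bar>(f (y, w) i - f (origin, w) i) - (f (x, v) i - f (origin, v) i)\<bar>"
        by (simp only: abs_mult)
      also have "\<dots> = t * \<bar>(f (y, w) i - f (origin, w) i) - (f (x, v) i - f (origin, v) i)\<bar>"
        by (simp add: t_def cutoff_def)
      also have "\<dots> \<le> t * (\<bar>f (x, v) i - f (origin, v) i\<bar> + \<bar>f (y, w) i - f (origin, w) i\<bar>)"
        by (rule mult_left_mono) (simp_all add: t_def cutoff_def)
      finally show "\<bar>f (origin, v) i - f (origin, w) i\<bar> \<le>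
          t * (\<bar>f (x, v) i - f (origin, v) i\<bar> + \<bar>f (y, w) i - f (origin, w) i\<bar>)" .
    qed
    also have "\<dots> < c"
    \<comment> \<open>At mass 0 the points \<open>x\<close> and \<open>y\<close> are not known to
      lie in \<open>K\<close>, but there \<open>t = 0\<close>.\<close>
    proof (cases "t = 0")
      case True
      then show ?thesis using c(1) by simp
    next
      case t: False
      then have "0 < menger_mass p" by (simp add: t_def cutoff_def max_def split: if_splits)
      then have "x \<in> K" "y \<in> K" by (rule xy)+
      then have d: "image_dist (x, v) (origin, v) < c / 2" "image_dist (y, w) (origin, w) < c / 2"
        using L V menger_point_bounds by (simp_all add: x_def y_def)
      have "0 < t" "t \<le> 1" using t by (auto simp: t_def cutoff_def)
      moreover have "0 \<le> image_dist a b" for a b by (simp add: image_dist_def sum_nonneg)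
      ultimately have "t * (image_dist (x, v) (origin, v) + image_dist (y, w) (origin, w)) \<le>
          1 * (image_dist (x, v) (origin, v) + image_dist (y, w) (origin, w))"
        by (intro mult_right_mono add_nonneg_nonneg)
      with d show ?thesis by simp
    qed
    finally show False by simp
  qed
qed

end

section \<open>From the abstract topologies to sets of functions\<close>

lemma menger_set_subset_Euclidean: "menger_set n m \<subseteq> topspace (Euclidean_space m)"
  by (auto simp: menger_set_def grid_cube_def)

text \<open>The function type itself carries the product topology, so abstract continuity becomes
  \<open>continuous_on\<close>.\<close>

lemma Euclidean_space_eq_top_of_set: "Euclidean_space m = top_of_set (topspace (Euclidean_space m))"
  by (simp add: Euclidean_space_def euclidean_product_topology subtopology_subtopology)

lemma subtopology_Euclidean_space:
  "subtopology (Euclidean_space m) S = top_of_set (topspace (Euclidean_space m) \<inter> S)"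
  by (subst Euclidean_space_eq_top_of_set) (simp add: subtopology_subtopology)

lemma unit_cube_eq: "unit_cube k = top_of_set (cube_points k)"
proof -
  have "topspace (Euclidean_space k) \<inter> {x. \<forall>i<k. 0 \<le> x i \<and> x i \<le> 1} = cube_points k"
    by (auto simp: topspace_Euclidean_space cube_points_def not_less order.antisym split: if_splits)
  then show ?thesis by (simp add: unit_cube_def subtopology_Euclidean_space)
qed

lemma menger_compactum_eq: "menger_compactum n = top_of_set (menger_set n (2 * n + 1))"
  unfolding menger_compactum_def subtopology_Euclidean_space
  using menger_set_subset_Euclidean by (simp only: Int_absorb1)

theorem corollary4p10:
  fixes n k :: nat
  assumes "n \<ge> 1"
  shows "\<not> (\<exists>f. embedding_map (prod_topology (menger_compactum n) (unit_cube k))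
                                (Euclidean_space (2 * n + k)) f)"
proof
  let ?X = "prod_topology (menger_compactum n) (unit_cube k)" and ?Y = "Euclidean_space (2 * n + k)"
  let ?P = "menger_set n (2 * n + 1) \<times> cube_points k"
  assume "\<exists>f. embedding_map ?X ?Y f"
  then obtain f where f: "embedding_map ?X ?Y f" by blast
  have X: "?X = top_of_set ?P"
    by (simp add: menger_compactum_eq unit_cube_eq flip: subtopology_Times)
  have cont: "continuous_map ?X ?Y f" using f by (simp add: embedding_map_def homeomorphic_eq_everything_map continuous_map_in_subtopology)
  have inj: "inj_on f ?P" using f by (simp add: X embedding_map_def homeomorphic_eq_everything_map)
  have im: "f p \<in> topspace ?Y" if "p \<in> ?P" for p
    using continuous_map_image_subset_topspace[OF cont] that by (auto simp: X)
  interpret injective_menger_map n k f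
  proof
    fix i
    have "continuous_map (top_of_set ?P) (top_of_set (topspace ?Y)) f"
      by (subst Euclidean_space_eq_top_of_set[symmetric], subst X[symmetric], rule cont)
    then have "continuous_on ?P f" by (simp add: continuous_map_in_subtopology)
    then show "continuous_on ?P (\<lambda>p. f p i)" by (rule continuous_on_product_then_coordinatewise)
  next
    fix p q assume pq: "p \<in> ?P" "q \<in> ?P" and eq: "\<And>i. i < 2 * n + k \<Longrightarrow> f p i = f q i"
    \<comment> \<open>From index \<open>2 * n + k\<close> on both images vanish, being points of the
      Euclidean space.\<close>
    have "f p i = f q i" for i
      using im[OF pq(1)] im[OF pq(2)] eq[of i] by (cases "i < 2 * n + k") (auto simp: topspace_Euclidean_space)
    then show "p = q" using inj_onD[OF inj _ pq] by blast
  qed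
  show False by (rule inconsistent)
qed

end
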